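(* Let $n \ge 1$ be an integer, $\sigma \in (0,1)$, $p \in \mathbb{R}$ and $q > -2\sigma$. There exist two positive constants $c$ and $C$ depending only on $n$, $\sigma$, $p$ and $q$, a family of functions $\{K_\lambda\}_{\lambda\ge 1} \subset C^\infty(\mathbb{R}^n)$ satisfying $$-C \le K_\lambda(x) \le -c, \quad c \le |\nabla K_\lambda(x)| \le C \quad \text{and} \quad |\nabla^2 K_\lambda(x)| \le C \qquad \text{for all } x \in B_2 \text{ and all } \lambda \ge 1,$$ and a family of positive functions $\{u_\lambda\}_{\lambda\ge1} \subset C^\infty(\mathbb{R}^n)$ satisfying $$(-\Delta)^\sigma u_\lambda = K_\lambda(x)\, u_\lambda^p \quad \text{in } \mathbb{R}^n, \qquad \lim_{|x|\to\infty} |x|^q u_\lambda(x) = 1$$ for every $\lambda\ge 1$, and $$\min_{\overline{B}_1} u_\lambda \to +\infty \quad \text{as } \lambda \to +\infty.$$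
   Context: $B_R$ denotes the open ball of radius $R$ centered at the origin in $\mathbb{R}^n$, and $\overline{B}_R$ its closure. $\nabla^2 K$ denotes the Hessian matrix of $K$. For $\sigma \in (0,1)$, the fractional Laplacian is defined by $$(-\Delta)^\sigma u(x) = c_{n,\sigma}\, \mathrm{P.V.} \int_{\mathbb{R}^n} \frac{u(x)-u(y)}{|x-y|^{n+2\sigma}}\,dy, \qquad c_{n,\sigma} = \frac{2^{2\sigma}\sigma\,\Gamma\left(\frac{n+2\sigma}{2}\right)}{\pi^{n/2}\,\Gamma(1-\sigma)},$$ where $\Gamma$ is the gamma function and the principal value is $\lim_{\varepsilon\to 0^+}$ of the integral over $\{|x-y|>\varepsilon\}$. It is well-defined at every point for $u \in C^\infty(\mathbb{R}^n)$ with $\int_{\mathbb{R}^n} \frac{|u(x)|}{1+|x|^{n+2\sigma}}\,dx < \infty$. *)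

theory Defs
  imports "HOL-Analysis.Analysis"
begin

definition partial_deriv :: "'n::finite \<Rightarrow> (real ^ 'n \<Rightarrow> real) \<Rightarrow> real ^ 'n \<Rightarrow> real" where
  "partial_deriv i f x = frechet_derivative f (at x) (axis i 1)"

text \<open>The functions of class \<open>C\<^sup>k\<close> on the whole space. Since \<^const>\<open>frechet_derivative\<close> is
  unspecified where the derivative does not exist, differentiability is required separately.\<close>

primrec C_k :: "nat \<Rightarrow> (real ^ 'n::finite \<Rightarrow> real) \<Rightarrow> bool" where
  "C_k 0 f \<longleftrightarrow> continuous_on UNIV f"
| "C_k (Suc k) f \<longleftrightarrow> f differentiable_on UNIV \<and> (\<forall>i. C_k k (partial_deriv i f))"

definition C_infinity :: "(real ^ 'n::finite \<Rightarrow> real) \<Rightarrow> bool" where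
  "C_infinity f \<longleftrightarrow> (\<forall>k. C_k k f)"

definition gradient :: "(real ^ 'n::finite \<Rightarrow> real) \<Rightarrow> real ^ 'n \<Rightarrow> real ^ 'n" where
  "gradient f x = (\<chi> i. partial_deriv i f x)"

text \<open>The norm of type \<^typ>\<open>real ^ 'n ^ 'n\<close> is the Frobenius norm.\<close>

definition hessian :: "(real ^ 'n::finite \<Rightarrow> real) \<Rightarrow> real ^ 'n \<Rightarrow> real ^ 'n ^ 'n" where
  "hessian f x = (\<chi> i j. partial_deriv i (partial_deriv j f) x)"

definition frac_laplacian_const :: "nat \<Rightarrow> real \<Rightarrow> real" where
  "frac_laplacian_const n \<sigma> =
     2 powr (2 * \<sigma>) * \<sigma> * Gamma ((real n + 2 * \<sigma>) / 2) / (pi powr (real n / 2) * Gamma (1 - \<sigma>))"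

text \<open>\<open>has_frac_laplacian \<sigma> u x L\<close> says that the principal value defining \<open>(-\<Delta>)\<^sup>\<sigma> u(x)\<close> exists
  and that \<open>(-\<Delta>)\<^sup>\<sigma> u(x) = L\<close>. Integrability of the truncated integrands is
  required explicitly because the Bochner integral of a non-integrable function is 0.\<close>

definition has_frac_laplacian ::
    "real \<Rightarrow> (real ^ 'n::finite \<Rightarrow> real) \<Rightarrow> real ^ 'n \<Rightarrow> real \<Rightarrow> bool" where
  "has_frac_laplacian \<sigma> u x L \<longleftrightarrow>
     (\<forall>\<epsilon>>0. set_integrable lborel {y. \<epsilon> < norm (x - y)}
        (\<lambda>y. (u x - u y) / norm (x - y) powr (real CARD('n) + 2 * \<sigma>))) \<and>
     ((\<lambda>\<epsilon>. frac_laplacian_const CARD('n) \<sigma> *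
        (LINT y:{y. \<epsilon> < norm (x - y)}|lborel.
           (u x - u y) / norm (x - y) powr (real CARD('n) + 2 * \<sigma>))) \<longlongrightarrow> L) (at_right 0)"

end

theory Submission
  imports Defs
begin

text \<open>Write \<open>u = l A(x/R) + R\<^sup>-\<^sup>q T(x/R) + l\<^sup>p P(x)\<close>. Here \<open>A\<close> is 1 on the unit ball and decays fast, \<open>T\<close>
  vanishes on the unit ball and behaves like \<open>|x|\<^sup>-\<^sup>q\<close> at infinity, and \<open>P\<close> is positive exactly on the
  half space \<open>x\<^sub>i > 3\<close>. For \<open>R \<ge> 3\<close> one has \<open>u = l\<close> on \<open>B\<^sub>2\<close>, so that on \<open>B\<^sub>2\<close>
  \<open>K = l\<^sup>-\<^sup>p (-\<Delta>)\<^sup>\<sigma> u = (-\<Delta>)\<^sup>\<sigma> P + l\<^sup>1\<^sup>-\<^sup>p R\<^sup>-\<^sup>2\<^sup>\<sigma> ((-\<Delta>)\<^sup>\<sigma> A)(x/R) + l\<^sup>-\<^sup>p R\<^sup>-\<^sup>q\<^sup>-\<^sup>2\<^sup>\<sigma> ((-\<Delta>)\<^sup>\<sigma> T)(x/R)\<close>.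
  As \<open>q > -2\<sigma>\<close>, choosing \<open>R\<close> large in terms of \<open>l\<close> makes the last two terms small in \<open>C\<^sup>2\<close>. The first
  term does not depend on \<open>l\<close>; it is negative and strictly decreasing in the direction \<open>e\<^sub>i\<close> on \<open>B\<^sub>2\<close>,
  because the mass of \<open>P\<close> lies on one side of the ball.\<close>

section \<open>Partial derivatives\<close>

text \<open>The operator is nonlocal: a function equal to the constant l on B_2 still has a nonzero
  fractional Laplacian there, and its values outside the ball decide the sign and the gradient. K is
  defined as \<open>L l x * u l x powr (- p)\<close>, with L the fractional Laplacian of u, so the
  equation holds by construction and all that remains is to control K on the ball. The weight l^p on
  P cancels the factor l^(-p), which makes c and C independent of l. The half space lies at distance
  1 from the ball, so the kernel seen from B_2 is nonsingular on it. For q < 0 the solutions may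
  grow, hence the fractional Laplacian has to be differentiated for unbounded functions. The class
  \<open>growth\<close> asks all derivatives to obey one weight bound. Second differences then have
  a common majorant, whose tail is integrable because q > -2\<sigma>, and derivatives pass through
  the integral. A and P only have to decay faster than |x|^(-q). Algebraic decay suffices, so every
  summand has an explicit formula and no compactly supported cutoff is built. Positivity of u comes
  from A > 0 everywhere.\<close>

lemma partial_deriv_eq:
  assumes "(f has_derivative f') (at x)"
  shows "partial_deriv i f x = f' (axis i 1)"
  using frechet_derivative_at[OF assms] by (simp add: partial_deriv_def)

lemma has_derivative_partial_deriv:
  fixes f :: "real ^ 'n::finite \<Rightarrow> real"
  assumes "f differentiable (at x)"
  shows "(f has_derivative (\<lambda>h. \<Sum>i\<in>UNIV. h $ i * partial_deriv i f x)) (at x)"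
proof -
  let ?D = "frechet_derivative f (at x)"
  have D: "(f has_derivative ?D) (at x)"
    using assms frechet_derivative_works by blast
  interpret bounded_linear ?D
    using D by (rule has_derivative_bounded_linear)
  have "?D = (\<lambda>h. \<Sum>i\<in>UNIV. h $ i * partial_deriv i f x)"
  proof
    fix h
    have "?D h = ?D (\<Sum>i\<in>UNIV. (h $ i) *\<^sub>R axis i 1)"
      using basis_expansion[of h] by (simp add: scalar_mult_eq_scaleR)
    also have "\<dots> = (\<Sum>i\<in>UNIV. h $ i * partial_deriv i f x)"
      by (simp add: sum scaleR partial_deriv_def)
    finally show "?D h = (\<Sum>i\<in>UNIV. h $ i * partial_deriv i f x)" .
  qed
  with D show ?thesis
    by simp
qed

lemma partial_deriv_has_derivative_sum:
  fixes f :: "real ^ 'n::finite \<Rightarrow> real"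
  assumes "(f has_derivative (\<lambda>h. \<Sum>i\<in>UNIV. h $ i * d i)) (at x)"
  shows "partial_deriv i f x = d i"
  using partial_deriv_eq[OF assms, of i] by (simp add: axis_def if_distrib[of "\<lambda>t. t * _"] cong: if_cong)

lemma partial_deriv_const [simp]: "partial_deriv i (\<lambda>x. c) = (\<lambda>x. 0)"
  by (simp add: fun_eq_iff partial_deriv_def)

lemma partial_deriv_add:
  assumes "f differentiable (at x)" "g differentiable (at x)"
  shows "partial_deriv i (\<lambda>x. f x + g x) x = partial_deriv i f x + partial_deriv i g x"
proof -
  have "((\<lambda>x. f x + g x) has_derivative
      (\<lambda>h. frechet_derivative f (at x) h + frechet_derivative g (at x) h)) (at x)"
    using assms by (intro has_derivative_add) (auto simp: frechet_derivative_works)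
  from partial_deriv_eq[OF this] show ?thesis by (simp add: partial_deriv_def)
qed

lemma partial_deriv_diff:
  assumes "f differentiable (at x)" "g differentiable (at x)"
  shows "partial_deriv i (\<lambda>x. f x - g x) x = partial_deriv i f x - partial_deriv i g x"
proof -
  have "((\<lambda>x. f x - g x) has_derivative
      (\<lambda>h. frechet_derivative f (at x) h - frechet_derivative g (at x) h)) (at x)"
    using assms by (intro has_derivative_diff) (auto simp: frechet_derivative_works)
  from partial_deriv_eq[OF this] show ?thesis by (simp add: partial_deriv_def)
qed

lemma partial_deriv_mult:
  assumes "f differentiable (at x)" "g differentiable (at x)"
  shows "partial_deriv i (\<lambda>x. f x * g x) x = f x * partial_deriv i g x + partial_deriv i f x * g x"
proof -
  have "((\<lambda>x. f x * g x) has_derivative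
      (\<lambda>h. f x * frechet_derivative g (at x) h + frechet_derivative f (at x) h * g x)) (at x)"
    using assms by (intro has_derivative_mult) (auto simp: frechet_derivative_works)
  from partial_deriv_eq[OF this] show ?thesis by (simp add: partial_deriv_def)
qed

lemma partial_deriv_cmult:
  assumes "f differentiable (at x)"
  shows "partial_deriv i (\<lambda>x. c * f x) x = c * partial_deriv i f x"
  using partial_deriv_mult[of "\<lambda>_. c" x f i] assms by simp

lemma partial_deriv_component:
  "partial_deriv i (\<lambda>x::real ^ 'n::finite. x $ j) = (\<lambda>x. if i = j then 1 else 0)"
proof
  fix x :: "real ^ 'n"
  have "((\<lambda>x::real ^ 'n. x $ j) has_derivative (\<lambda>h. h $ j)) (at x)"
    by (rule bounded_linear.has_derivative[OF bounded_linear_vec_nth has_derivative_ident])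
  from partial_deriv_eq[OF this]
  show "partial_deriv i (\<lambda>x::real ^ 'n. x $ j) x = (if i = j then 1 else 0)"
    by (auto simp: axis_def)
qed

lemma differentiable_DERIV_compose:
  fixes f :: "'a::real_normed_vector \<Rightarrow> real"
  assumes "f differentiable (at x)" "(\<phi> has_real_derivative d) (at (f x))"
  shows "(\<lambda>x. \<phi> (f x)) differentiable (at x)"
  using differentiable_chain_at[of f x \<phi>] assms
  by (auto simp: o_def real_differentiable_def)

lemma partial_deriv_DERIV_compose:
  assumes "f differentiable (at x)" "(\<phi> has_real_derivative d) (at (f x))"
  shows "partial_deriv i (\<lambda>x. \<phi> (f x)) x = d * partial_deriv i f x"
proof -
  have "((\<lambda>x. \<phi> (f x)) has_derivative (\<lambda>h. d * frechet_derivative f (at x) h)) (at x)"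
    using diff_chain_at[of f "frechet_derivative f (at x)" x \<phi> "\<lambda>h. d * h"] assms
    by (simp add: o_def has_field_derivative_def frechet_derivative_works)
  from partial_deriv_eq[OF this] show ?thesis by (simp add: partial_deriv_def)
qed

lemma
  assumes "f differentiable (at (a + c *\<^sub>R x))"
  shows differentiable_affine_compose: "(\<lambda>x. f (a + c *\<^sub>R x)) differentiable (at x)" (is ?A)
    and partial_deriv_affine_compose:
      "partial_deriv i (\<lambda>x. f (a + c *\<^sub>R x)) x = c * partial_deriv i f (a + c *\<^sub>R x)" (is ?B)
proof -
  let ?D = "frechet_derivative f (at (a + c *\<^sub>R x))"
  have g: "((\<lambda>x. a + c *\<^sub>R x) has_derivative (\<lambda>h. c *\<^sub>R h)) (at x)"
    by (auto intro!: derivative_eq_intros)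
  have D: "(f has_derivative ?D) (at (a + c *\<^sub>R x))"
    using assms frechet_derivative_works by blast
  have d: "((\<lambda>x. f (a + c *\<^sub>R x)) has_derivative (\<lambda>h. ?D (c *\<^sub>R h))) (at x)"
    using diff_chain_at[OF g D] by (simp add: o_def)
  then show ?A by (auto simp: differentiable_def)
  show ?B
    using partial_deriv_eq[OF d] D
    by (simp add: partial_deriv_def linear_cmul[OF has_derivative_linear])
qed

text \<open>Derivatives are local. This lets K be differentiated on the ball through the simpler
  expression that it equals there and nowhere else.\<close>

lemma partial_deriv_cong_open:
  assumes "open S" "x \<in> S" "\<And>y. y \<in> S \<Longrightarrow> f y = g y"
  shows "partial_deriv i f x = partial_deriv i g x"
proof -
  have "(f has_derivative f') (at x) = (g has_derivative f') (at x)" for f'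
    using assms has_derivative_transform_within_open[of f f' x UNIV S g]
      has_derivative_transform_within_open[of g f' x UNIV S f] by auto
  then show ?thesis
    by (simp add: partial_deriv_def frechet_derivative_def)
qed

text \<open>The mean value inequality in coordinates; the dimension enters by bounding each of the n
  terms of the derivative separately.\<close>

lemma partial_deriv_bound:
  fixes f :: "real ^ 'n::finite \<Rightarrow> real" and B :: real
  assumes "convex S" and d: "\<And>y. y \<in> S \<Longrightarrow> f differentiable (at y)"
    and B: "\<And>y i. y \<in> S \<Longrightarrow> \<bar>partial_deriv i f y\<bar> \<le> B"
    and "x \<in> S" "y \<in> S"
  shows "\<bar>f x - f y\<bar> \<le> CARD('n) * B * norm (x - y)"
proof -
  have "norm (f x - f y) \<le> (CARD('n) * B) * norm (x - y)"
  proof (rule differentiable_bound[OF \<open>convex S\<close> _ _ \<open>x \<in> S\<close> \<open>y \<in> S\<close>])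
    fix z assume z: "z \<in> S"
    show "(f has_derivative (\<lambda>h. \<Sum>i\<in>UNIV. h $ i * partial_deriv i f z)) (at z within S)"
      using has_derivative_partial_deriv[OF d[OF z]] has_derivative_at_withinI by blast
    show "onorm (\<lambda>h. \<Sum>i\<in>UNIV. h $ i * partial_deriv i f z) \<le> CARD('n) * B"
    proof (rule onorm_le)
      fix h :: "real ^ 'n"
      have "norm (\<Sum>i\<in>UNIV. h $ i * partial_deriv i f z) \<le> (\<Sum>i\<in>(UNIV::'n set). norm h * B)"
        by (intro order_trans[OF norm_sum] sum_mono)
          (auto simp: abs_mult intro!: mult_mono component_le_norm_cart B z)
      then show "norm (\<Sum>i\<in>UNIV. h $ i * partial_deriv i f z) \<le> CARD('n) * B * norm h"
        by (simp add: mult_ac)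
    qed
  qed
  then show ?thesis by simp
qed

text \<open>The mean value inequality is used twice: for each partial derivative, and for f minus
  its linear part at x, whose gradient is then of order \<open>norm h\<close>. Each use contributes
  one factor \<open>CARD('n)\<close>.\<close>

lemma partial_deriv_taylor:
  fixes f :: "real ^ 'n::finite \<Rightarrow> real" and B :: real
  assumes f: "\<And>y. f differentiable (at y)"
    and f': "\<And>y i. partial_deriv i f differentiable (at y)"
    and B: "\<And>y i j. y \<in> cball x (norm h) \<Longrightarrow> \<bar>partial_deriv i (partial_deriv j f) y\<bar> \<le> B"
  shows "\<bar>f (x + h) - f x - (\<Sum>i\<in>UNIV. h $ i * partial_deriv i f x)\<bar> \<le> (CARD('n))\<^sup>2 * B * (norm h)\<^sup>2"
proof -
  define L where "L y = (\<Sum>i\<in>UNIV. (y - x) $ i * partial_deriv i f x)" for y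
  define g where "g y = f y - L y" for y
  have L: "(L has_derivative (\<lambda>h. \<Sum>i\<in>UNIV. h $ i * partial_deriv i f x)) (at y)" for y
    unfolding L_def
    by (auto intro!: derivative_eq_intros bounded_linear.has_derivative[OF bounded_linear_vec_nth])
  have dg: "(g has_derivative (\<lambda>h. \<Sum>i\<in>UNIV. h $ i * (partial_deriv i f y - partial_deriv i f x))) (at y)" for y
    using has_derivative_diff[OF has_derivative_partial_deriv[OF f[of y]] L[of y]]
    unfolding g_def by (simp add: right_diff_distrib sum_subtractf)
  have "\<bar>g (x + h) - g x\<bar> \<le> CARD('n) * (CARD('n) * B * norm h) * norm ((x + h) - x)"
  proof (rule partial_deriv_bound[where S = "cball x (norm h)"])
    fix y assume y: "y \<in> cball x (norm h)"
    show "g differentiable at y" using dg by (auto simp: differentiable_def)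
    fix i
    have "\<bar>partial_deriv i f y - partial_deriv i f x\<bar> \<le> CARD('n) * B * norm (y - x)"
      by (rule partial_deriv_bound[where S = "cball x (norm h)"]) (use y f' B in auto)
    also have "\<dots> \<le> CARD('n) * B * norm h"
      using y B[of x i i] by (intro mult_left_mono) (auto simp: dist_norm norm_minus_commute)
    finally show "\<bar>partial_deriv i g y\<bar> \<le> CARD('n) * B * norm h"
      using partial_deriv_has_derivative_sum[OF dg] by simp
  qed (auto simp: dist_norm)
  then show ?thesis
    by (simp add: g_def L_def power2_eq_square algebra_simps)
qed

section \<open>Smooth functions of polynomial growth\<close>

text \<open>Comparable to (1 + |x|)^2 but polynomial in x, so that all its real powers are smooth,
  also at the origin.\<close>

definition wt :: "'a::real_inner \<Rightarrow> real" where
  "wt x = 1 + (norm x)\<^sup>2"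

lemma wt_ge_1 [simp]: "1 \<le> wt x"
  by (simp add: wt_def)

lemma wt_pos [simp]: "0 < wt x"
  using wt_ge_1[of x] by linarith

lemma wt_nz [simp]: "wt x \<noteq> 0"
  using wt_pos[of x] by linarith

text \<open>A form of Peetre's inequality: a translation costs only a factor depending on the
  translation vector.\<close>

lemma wt_add_le: "wt (x + y) \<le> 2 * wt x * wt y"
proof -
  have "(norm (x + y))\<^sup>2 \<le> (norm x + norm y)\<^sup>2"
    by (intro power_mono norm_triangle_ineq) simp
  also have "\<dots> \<le> 2 * (norm x)\<^sup>2 + 2 * (norm y)\<^sup>2"
    using sum_squares_bound[of "norm x" "norm y"] by (simp add: power2_sum)
  finally have "(norm (x + y))\<^sup>2 \<le> 2 * (norm x)\<^sup>2 + 2 * (norm y)\<^sup>2" .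
  moreover have "0 \<le> (norm x)\<^sup>2 * (norm y)\<^sup>2" by simp
  ultimately show ?thesis
    unfolding wt_def distrib_left distrib_right by linarith
qed

lemma has_derivative_wt: "(wt has_derivative (\<lambda>h. 2 * (x \<bullet> h))) (at x)"
proof -
  have "((\<lambda>x. 1 + x \<bullet> x) has_derivative (\<lambda>h. 2 * (x \<bullet> h))) (at x)"
    by (auto intro!: derivative_eq_intros simp: inner_commute)
  then show ?thesis
    by (simp add: wt_def[abs_def] power2_norm_eq_inner)
qed

lemma differentiable_wt [simp]: "wt differentiable (at x)"
  using has_derivative_wt by (auto simp: differentiable_def)

lemma partial_deriv_wt: "partial_deriv i wt x = 2 * x $ i"
  using partial_deriv_eq[OF has_derivative_wt, of i x] by (simp add: inner_axis)

definition wt_bdd :: "real \<Rightarrow> ('a::real_inner \<Rightarrow> real) \<Rightarrow> bool" where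
  "wt_bdd a f \<longleftrightarrow> (\<exists>C. \<forall>x. \<bar>f x\<bar> \<le> C * wt x powr a)"

lemma wt_bddI: "(\<And>x. \<bar>f x\<bar> \<le> C * wt x powr a) \<Longrightarrow> wt_bdd a f"
  unfolding wt_bdd_def by blast

lemma wt_bddE:
  fixes f :: "'a::real_inner \<Rightarrow> real"
  assumes "wt_bdd a f"
  obtains C where "0 \<le> C" "\<And>x. \<bar>f x\<bar> \<le> C * wt x powr a"
proof -
  obtain C where C: "\<And>x. \<bar>f x\<bar> \<le> C * wt x powr a"
    using assms unfolding wt_bdd_def by blast
  have "0 \<le> C * wt (0::'a) powr a" by (rule order_trans[OF abs_ge_zero C])
  then have "0 \<le> C" by (simp add: wt_def)
  with C that show ?thesis by blast
qed

lemma wt_bdd_mono: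
  assumes "wt_bdd a f" "a \<le> b"
  shows "wt_bdd b f"
proof -
  obtain C where C: "0 \<le> C" "\<And>x. \<bar>f x\<bar> \<le> C * wt x powr a"
    using assms(1) by (elim wt_bddE) blast
  have "\<bar>f x\<bar> \<le> C * wt x powr b" for x
    using C(2)[of x] mult_left_mono[OF powr_mono[OF \<open>a \<le> b\<close> wt_ge_1] C(1), of x] by linarith
  then show ?thesis by (rule wt_bddI)
qed

lemma wt_bdd_add:
  assumes "wt_bdd a f" "wt_bdd a g"
  shows "wt_bdd a (\<lambda>x. f x + g x)"
proof -
  obtain C D where CD: "\<And>x. \<bar>f x\<bar> \<le> C * wt x powr a" "\<And>x. \<bar>g x\<bar> \<le> D * wt x powr a"
    using assms by (elim wt_bddE) blast
  have "\<bar>f x + g x\<bar> \<le> (C + D) * wt x powr a" for x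
    using CD[of x] unfolding distrib_right by linarith
  then show ?thesis by (rule wt_bddI)
qed

lemma wt_bdd_mult:
  assumes "wt_bdd a f" "wt_bdd b g"
  shows "wt_bdd (a + b) (\<lambda>x. f x * g x)"
proof -
  obtain C D where CD: "\<And>x. \<bar>f x\<bar> \<le> C * wt x powr a" "\<And>x. \<bar>g x\<bar> \<le> D * wt x powr b"
    using assms by (elim wt_bddE) blast
  have "\<bar>f x * g x\<bar> \<le> (C * D) * wt x powr (a + b)" for x
    using mult_mono'[OF CD] by (simp add: abs_mult powr_add mult_ac)
  then show ?thesis by (rule wt_bddI)
qed

text \<open>As \<open>wt\<close> is quadratic, the exponent \<open>a\<close> stands for growth of order \<open>|x|\<^sup>2\<^sup>a\<close>.\<close>

primrec growth :: "real \<Rightarrow> nat \<Rightarrow> (real ^ 'n::finite \<Rightarrow> real) \<Rightarrow> bool" where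
  "growth a 0 f \<longleftrightarrow> wt_bdd a f"
| "growth a (Suc k) f \<longleftrightarrow> wt_bdd a f \<and> (\<forall>x. f differentiable (at x)) \<and>
     (\<forall>i. growth a k (partial_deriv i f))"

lemma growth_wt_bdd: "growth a k f \<Longrightarrow> wt_bdd a f"
  by (cases k) auto

lemma growth_SucD: "growth a (Suc k) f \<Longrightarrow> growth a k f"
  by (induction k arbitrary: f) auto

lemma growth_mono: "growth a k f \<Longrightarrow> a \<le> b \<Longrightarrow> growth b k f"
  by (induction k arbitrary: f) (auto intro: wt_bdd_mono)

lemma growth_const: "growth 0 k (\<lambda>_. c)"
  by (induction k arbitrary: c) (auto intro!: wt_bddI[where C = "\<bar>_\<bar>"])

lemma growth_add:
  "growth a k f \<Longrightarrow> growth a k g \<Longrightarrow> growth a k (\<lambda>x. f x + g x)"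
proof (induction k arbitrary: f g)
  case (Suc k)
  then have "partial_deriv i (\<lambda>x. f x + g x) = (\<lambda>x. partial_deriv i f x + partial_deriv i g x)" for i
    by (intro ext partial_deriv_add) auto
  with Suc show ?case by (auto intro: wt_bdd_add)
qed (auto intro: wt_bdd_add)

lemma growth_mult:
  "growth a k f \<Longrightarrow> growth b k g \<Longrightarrow> growth (a + b) k (\<lambda>x. f x * g x)"
proof (induction k arbitrary: f g)
  case (Suc k)
  have f: "growth a k f" and g: "growth b k g" using Suc.prems growth_SucD by blast+
  have d: "f differentiable (at x)" "g differentiable (at x)" for x using Suc.prems by auto
  have "growth (a + b) k (partial_deriv i (\<lambda>x. f x * g x))" for i
  proof -
    have "partial_deriv i (\<lambda>x. f x * g x) = (\<lambda>x. f x * partial_deriv i g x + partial_deriv i f x * g x)"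
      using d by (intro ext partial_deriv_mult) auto
    then show ?thesis
      using Suc.prems f g by (auto intro!: growth_add Suc.IH)
  qed
  then show ?case
    using d Suc.prems by (auto intro!: differentiable_mult wt_bdd_mult)
qed (auto intro: wt_bdd_mult)

lemma growth_cmult: "growth a k f \<Longrightarrow> growth a k (\<lambda>x. c * f x)"
  using growth_mult[OF growth_const, of a k f c] by simp

lemma growth_power: "growth 0 k f \<Longrightarrow> growth 0 k (\<lambda>x. f x ^ m)"
  by (induction m) (auto intro: growth_const growth_mult[where a = 0 and b = 0, simplified])

lemma growth_component: "growth (1 / 2) k (\<lambda>x::real ^ 'n::finite. x $ j)"
proof -
  have "\<bar>x $ j\<bar> \<le> 1 * wt x powr (1 / 2)" for x :: "real ^ 'n"
  proof -
    have "\<bar>x $ j\<bar> \<le> norm x" by (rule component_le_norm_cart)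
    also have "\<dots> \<le> sqrt (wt x)" by (rule real_le_rsqrt) (simp add: wt_def)
    finally show ?thesis by (simp add: powr_half_sqrt less_imp_le)
  qed
  then have "wt_bdd (1 / 2) (\<lambda>x::real ^ 'n. x $ j)" by (rule wt_bddI)
  moreover have "growth (1 / 2) l (\<lambda>x. c)" for l c
    by (rule growth_mono[OF growth_const]) simp
  moreover have "(\<lambda>x::real ^ 'n. x $ j) differentiable (at x)" for x
    by (simp add: bounded_linear_imp_differentiable bounded_linear_vec_nth)
  ultimately show ?thesis
    by (cases k) (auto simp: partial_deriv_component)
qed

text \<open>A derivative lowers the exponent by 1 and produces a coordinate, which costs 1/2. The
  net exponent a - 1/2 is below a, so the bound with a persists in all orders.\<close>

lemma growth_wt_powr: "growth a k (\<lambda>x::real ^ 'n::finite. wt x powr a)"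
proof (induction k arbitrary: a)
  case 0
  show ?case by (auto intro!: wt_bddI[where C = 1])
next
  case (Suc k)
  have D: "((\<lambda>t. t powr a) has_real_derivative a * wt x powr (a - 1)) (at (wt x))" for x :: "real ^ 'n"
    by (rule has_real_derivative_powr) simp
  have "partial_deriv i (\<lambda>x. wt x powr a) = (\<lambda>x. 2 * a * (wt x powr (a - 1) * x $ i))" for i :: 'n
    by (intro ext) (simp add: partial_deriv_DERIV_compose[OF differentiable_wt D] partial_deriv_wt)
  moreover have "growth a k (\<lambda>x. 2 * a * (wt x powr (a - 1) * x $ i))" for i :: 'n
    by (intro growth_cmult growth_mono[OF growth_mult[OF Suc growth_component]]) auto
  moreover have "(\<lambda>x. wt x powr a) differentiable (at x)" for x :: "real ^ 'n"
    by (rule differentiable_DERIV_compose[OF differentiable_wt D])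
  ultimately show ?case by (auto intro!: wt_bddI[where C = 1])
qed

section \<open>Closure properties of the classes C^k\<close>

lemma C_k_SucD: "C_k (Suc k) f \<Longrightarrow> C_k k f"
  by (induction k arbitrary: f) (auto simp: differentiable_imp_continuous_on)

lemma C_k_const: "C_k k (\<lambda>_. c)"
  by (induction k arbitrary: c) auto

lemma differentiable_on_UNIV: "f differentiable_on UNIV \<longleftrightarrow> (\<forall>x. f differentiable (at x))"
  by (simp add: differentiable_on_def)

text \<open>At its top order \<open>growth\<close> carries a bound but no continuity. Continuity of
  the derivatives of order k is obtained from differentiability one order higher.\<close>

lemma growth_imp_C_k: "growth a (Suc k) f \<Longrightarrow> C_k k f"
proof (induction k arbitrary: f)
  case 0
  then show ?case
    by (auto intro!: differentiable_imp_continuous_on simp: differentiable_on_UNIV)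
qed (auto simp: differentiable_on_UNIV)

lemma C_k_add: "C_k k f \<Longrightarrow> C_k k g \<Longrightarrow> C_k k (\<lambda>x. f x + g x)"
proof (induction k arbitrary: f g)
  case (Suc k)
  then have "partial_deriv i (\<lambda>x. f x + g x) = (\<lambda>x. partial_deriv i f x + partial_deriv i g x)" for i
    by (intro ext partial_deriv_add) (auto simp: differentiable_on_UNIV)
  with Suc show ?case by (auto simp: differentiable_on_UNIV)
qed (auto intro: continuous_on_add)

lemma C_k_mult: "C_k k f \<Longrightarrow> C_k k g \<Longrightarrow> C_k k (\<lambda>x. f x * g x)"
proof (induction k arbitrary: f g)
  case (Suc k)
  have "C_k k f" "C_k k g" using Suc.prems C_k_SucD by blast+
  moreover have "partial_deriv i (\<lambda>x. f x * g x) = (\<lambda>x. f x * partial_deriv i g x + partial_deriv i f x * g x)" for i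
    using Suc.prems by (intro ext partial_deriv_mult) (auto simp: differentiable_on_UNIV)
  ultimately show ?case
    using Suc by (auto simp: differentiable_on_UNIV intro!: C_k_add differentiable_mult)
qed (auto intro: continuous_on_mult)

lemma C_k_scaleR: "C_k k f \<Longrightarrow> C_k k (\<lambda>x. f (c *\<^sub>R x))"
proof (induction k arbitrary: f)
  case 0
  then show ?case by (auto intro!: continuous_on_compose2[of UNIV f] continuous_intros)
next
  case (Suc k)
  have d: "f differentiable (at x)" for x using Suc.prems by (auto simp: differentiable_on_UNIV)
  have "partial_deriv i (\<lambda>x. f (c *\<^sub>R x)) = (\<lambda>x. c * partial_deriv i f (c *\<^sub>R x))" for i
    using partial_deriv_affine_compose[of f 0 c] d by (intro ext) simp
  moreover have "(\<lambda>x. f (c *\<^sub>R x)) differentiable (at x)" for x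
    using differentiable_affine_compose[of f 0 c] d by simp
  ultimately show ?case
    using Suc by (auto simp: differentiable_on_UNIV intro!: C_k_mult C_k_const)
qed

lemma C_k_powr:
  assumes "\<And>x. 0 < f x"
  shows "C_k k f \<Longrightarrow> C_k k (\<lambda>x. f x powr a)"
proof (induction k arbitrary: a)
  case 0
  then show ?case using assms by (auto intro!: continuous_intros simp: less_imp_neq[THEN not_sym])
next
  case (Suc k)
  have d: "f differentiable (at x)" for x using Suc.prems by (auto simp: differentiable_on_UNIV)
  have D: "((\<lambda>t. t powr a) has_real_derivative a * f x powr (a - 1)) (at (f x))" for x
    using assms by (rule has_real_derivative_powr)
  have "partial_deriv i (\<lambda>x. f x powr a) = (\<lambda>x. a * f x powr (a - 1) * partial_deriv i f x)" for i
    by (intro ext partial_deriv_DERIV_compose[OF d D])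
  moreover have "(\<lambda>x. f x powr a) differentiable (at x)" for x
    by (rule differentiable_DERIV_compose[OF d D])
  ultimately show ?case
    using Suc C_k_SucD[OF Suc.prems] by (auto simp: differentiable_on_UNIV intro!: C_k_mult C_k_const)
qed

section \<open>A flat function\<close>

text \<open>The powers t^(-m) are included so that the family is closed under differentiation: the
  derivative of a member is a linear combination of two others, and smoothness follows by induction
  over all m at once.\<close>

definition flat :: "nat \<Rightarrow> real \<Rightarrow> real" where
  "flat m t = (if 0 < t then inverse t ^ m * exp (- inverse t) else 0)"

lemma flat_nonneg: "0 \<le> flat m t"
  by (simp add: flat_def)

lemma flat_nonpos [simp]: "t \<le> 0 \<Longrightarrow> flat m t = 0"
  by (simp add: flat_def)

lemma flat_pos: "0 < t \<Longrightarrow> 0 < flat m t"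
  by (simp add: flat_def)

text \<open>The left side divided by \<open>fact m\<close> is a single term of the exponential
  series, all of whose terms are nonnegative.\<close>

lemma power_le_fact_exp:
  fixes s :: real
  assumes "0 \<le> s"
  shows "s ^ m \<le> fact m * exp s"
proof -
  have "(\<Sum>k\<in>{m}. s ^ k /\<^sub>R fact k) \<le> (\<Sum>k. s ^ k /\<^sub>R fact k)"
    using assms by (intro sum_le_suminf summable_exp_generic) auto
  then have "s ^ m / fact m \<le> exp s"
    by (simp add: exp_def divide_inverse_commute)
  then show ?thesis by (simp add: field_simps)
qed

lemma flat_le_fact: "flat m t \<le> fact m"
proof (cases "0 < t")
  case True
  then have "inverse t ^ m * exp (- inverse t) \<le> fact m * exp (inverse t) * exp (- inverse t)"
    by (intro mult_right_mono power_le_fact_exp) auto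
  also have "\<dots> = fact m" by (simp add: mult.assoc flip: exp_add)
  finally show ?thesis using True by (simp add: flat_def)
qed simp

lemma DERIV_flat:
  "(flat m has_real_derivative flat (m + 2) t - real m * flat (m + 1) t) (at t)"
proof -
  consider "0 < t" | "t < 0" | "t = 0" by linarith
  then show ?thesis
  proof cases
    case 1
    have "((\<lambda>s. s ^ m * exp (- s)) has_real_derivative
        real m * s ^ (m - 1) * exp (- s) - s ^ m * exp (- s)) (at s)" for s
      by (auto intro!: derivative_eq_intros)
    moreover have "(inverse has_real_derivative - (inverse t ^ 2)) (at t)"
      using 1 DERIV_inverse[of t UNIV] by (simp add: numeral_2_eq_2)
    ultimately have "((\<lambda>t. inverse t ^ m * exp (- inverse t)) has_real_derivative
        (real m * inverse t ^ (m - 1) * exp (- inverse t) - inverse t ^ m * exp (- inverse t)) *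
        - (inverse t ^ 2)) (at t)"
      by (rule DERIV_chain2)
    \<comment> \<open>The case split on m deals with the truncated \<open>m - 1\<close>: for m = 0
      the factor \<open>real m\<close> removes that term.\<close>
    moreover have "(real m * s ^ (m - 1) * e - s ^ m * e) * - (s ^ 2) =
        s ^ (m + 2) * e - real m * (s ^ (m + 1) * e)" for s e :: real
      by (cases m) (simp_all add: power2_eq_square algebra_simps)
    ultimately have "((\<lambda>t. inverse t ^ m * exp (- inverse t)) has_real_derivative
        flat (m + 2) t - real m * flat (m + 1) t) (at t)"
      using 1 by (simp only: flat_def if_True)
    then show ?thesis
      by (rule has_field_derivative_transform_within_open[where S = "{0<..}"]) (use 1 in \<open>auto simp: flat_def\<close>)
  next
    case 2
    have "((\<lambda>_. 0) has_real_derivative 0) (at t)" by simp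
    then have "(flat m has_real_derivative 0) (at t)"
      by (rule has_field_derivative_transform_within_open[where S = "{..<0}"]) (use 2 in auto)
    then show ?thesis using 2 by simp
  next
    case 3
    have "((\<lambda>h. (flat m (0 + h) - flat m 0) / h) \<longlongrightarrow> 0) (at 0)"
    proof (rule Lim_null_comparison)
      show "\<forall>\<^sub>F h in at 0. norm ((flat m (0 + h) - flat m 0) / h) \<le> fact (m + 2) * \<bar>h\<bar>"
      proof (intro always_eventually allI)
        fix h :: real
        \<comment> \<open>At the junction the difference quotient is again a flat function times h;
          boundedness of \<open>flat (m + 2)\<close> makes it vanish in the limit.\<close>
        have "flat m h / h = flat (m + 2) h * h"
          by (auto simp: flat_def power2_eq_square field_simps)
        then show "norm ((flat m (0 + h) - flat m 0) / h) \<le> fact (m + 2) * \<bar>h\<bar>"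
          using mult_right_mono[OF flat_le_fact[of "m + 2" h], of "\<bar>h\<bar>"] flat_nonneg[of "m + 2" h]
          by (simp add: abs_mult del: fact_Suc)
      qed
      show "((\<lambda>h. fact (m + 2) * \<bar>h\<bar>) \<longlongrightarrow> 0) (at (0::real))"
        by (rule tendsto_eq_intros | simp)+
    qed
    then show ?thesis using 3 by (simp add: DERIV_def)
  qed
qed

lemma partial_deriv_flat:
  assumes "f differentiable (at x)"
  shows "partial_deriv i (\<lambda>x. flat m (f x)) x =
    flat (m + 2) (f x) * partial_deriv i f x + (- real m) * (flat (m + 1) (f x) * partial_deriv i f x)"
  using partial_deriv_DERIV_compose[OF assms DERIV_flat] by (simp add: algebra_simps)

text \<open>For large t, \<open>flat m t\<close> behaves like t^(-m), and t is quadratic in |x|;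
  this gives the exponent -m. A derivative replaces m by m + 1 or m + 2 and multiplies by a
  coordinate, which costs 1/2, so the exponent stays below -m.\<close>

lemma growth_flat_ball: "growth (- real m) k (\<lambda>x::real ^ 'n::finite. flat m ((norm x)\<^sup>2 - 1))"
proof (induction k arbitrary: m)
  have bd: "wt_bdd (- real m) (\<lambda>x::real ^ 'n. flat m ((norm x)\<^sup>2 - 1))" for m
  proof (rule wt_bddI)
    fix x :: "real ^ 'n"
    show "\<bar>flat m ((norm x)\<^sup>2 - 1)\<bar> \<le> 3 ^ m * fact m * wt x powr (- real m)"
    proof (cases "norm x \<le> 1")
      case True
      then show ?thesis by (simp add: power_le_one)
    next
      case False
      define t where "t = (norm x)\<^sup>2 - 1"
      have t: "0 < t" using False by (simp add: t_def one_less_power)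
      \<comment> \<open>Here \<open>t + 2\<close> is \<open>wt x\<close>. It is at most 3 when t
        \<le> 1 and at most 3t when t > 1; in the second case t^m cancels the inverse power in
        \<open>flat m t\<close>.\<close>
      have "flat m t * (t + 2) ^ m \<le> 3 ^ m * fact m"
      proof (cases "t \<le> 1")
        case True
        have "flat m t * (t + 2) ^ m \<le> fact m * 3 ^ m"
          using t True by (intro mult_mono flat_le_fact power_mono) auto
        then show ?thesis by (simp add: mult.commute)
      next
        case False
        have "flat m t * (t + 2) ^ m \<le> flat m t * (3 * t) ^ m"
          using t False by (intro mult_left_mono power_mono flat_nonneg) auto
        also have "\<dots> = 3 ^ m * exp (- inverse t)" using t by (simp add: flat_def power_mult_distrib power_inverse)
        also have "\<dots> \<le> 3 ^ m * fact m"
          using t by (intro mult_left_mono order_trans[OF _ fact_ge_1]) auto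
        finally show ?thesis .
      qed
      moreover have "t + 2 = wt x" by (simp add: t_def wt_def)
      ultimately have "flat m t * wt x ^ m \<le> 3 ^ m * fact m" by simp
      then have "flat m t \<le> 3 ^ m * fact m / wt x ^ m" by (simp add: pos_le_divide_eq)
      then show ?thesis
        by (simp add: flat_nonneg powr_minus powr_realpow divide_inverse t_def)
    qed
  qed
  {
    case 0
    show ?case using bd by auto
  next
    case (Suc k)
    let ?g = "\<lambda>x::real ^ 'n. (norm x)\<^sup>2 - 1"
    have g: "?g = (\<lambda>x. wt x + (- 2))" by (simp add: wt_def)
    have dg: "?g differentiable (at x)" for x
      unfolding g by (intro differentiable_add differentiable_wt differentiable_const)
    have pg: "partial_deriv i ?g x = 2 * x $ i" for i x
      unfolding g by (subst partial_deriv_add) (auto simp: partial_deriv_wt)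
    have "growth (- real m) k (\<lambda>x. flat (m + 2) (?g x) * (2 * x $ i) +
        (- real m) * (flat (m + 1) (?g x) * (2 * x $ i)))" for i
      by (intro growth_add growth_cmult growth_mono[OF growth_mult[OF Suc growth_cmult[OF growth_component]]]) auto
    moreover have "partial_deriv i (\<lambda>x. flat m (?g x)) = (\<lambda>x. flat (m + 2) (?g x) * (2 * x $ i) +
        (- real m) * (flat (m + 1) (?g x) * (2 * x $ i)))" for i
      by (intro ext) (simp only: partial_deriv_flat[OF dg] pg)
    moreover have "(\<lambda>x. flat m (?g x)) differentiable (at x)" for x
      by (rule differentiable_DERIV_compose[OF dg DERIV_flat])
    ultimately show ?case using bd by (simp only: growth.simps simp_thms)
  }
qed

text \<open>No decay can be claimed, as the function is constant along hyperplanes parallel to the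
  boundary. Weight 0 survives differentiation because the inner derivative is 0 or 1 and each
  \<open>flat m\<close> is bounded.\<close>

lemma growth_flat_halfspace: "growth 0 k (\<lambda>x::real ^ 'n::finite. flat m (x $ j - b))"
proof (induction k arbitrary: m)
  have bd: "wt_bdd 0 (\<lambda>x::real ^ 'n. flat m (x $ j - b))" for m
    using flat_le_fact flat_nonneg by (auto intro!: wt_bddI[where C = "fact m"])
  {
    case 0
    show ?case using bd by auto
  next
    case (Suc k)
    let ?g = "\<lambda>x::real ^ 'n. x $ j - b"
    have dc: "(\<lambda>x::real ^ 'n. x $ j) differentiable (at x)" for x
      by (simp add: bounded_linear_imp_differentiable bounded_linear_vec_nth)
    have dg: "?g differentiable (at x)" for x
      by (intro differentiable_diff dc differentiable_const)
    have pg: "partial_deriv i ?g x = (if i = j then 1 else 0)" for i x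
      using partial_deriv_add[OF dc, of "\<lambda>_. - b" x i] by (simp add: partial_deriv_component)
    have "growth 0 k (\<lambda>x. flat (m + 2) (?g x) * (if i = j then 1 else 0) +
        (- real m) * (flat (m + 1) (?g x) * (if i = j then 1 else 0)))" for i
      by (intro growth_add growth_cmult growth_mono[OF growth_mult[OF Suc growth_const]]) auto
    moreover have "partial_deriv i (\<lambda>x. flat m (?g x)) = (\<lambda>x. flat (m + 2) (?g x) * (if i = j then 1 else 0) +
        (- real m) * (flat (m + 1) (?g x) * (if i = j then 1 else 0)))" for i
      by (intro ext) (simp only: partial_deriv_flat[OF dg] pg)
    moreover have "(\<lambda>x. flat m (?g x)) differentiable (at x)" for x
      by (rule differentiable_DERIV_compose[OF dg DERIV_flat])
    ultimately show ?case using bd by (simp only: growth.simps simp_thms)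
  }
qed

section \<open>Second differences\<close>

lemma powr_le_dyadic:
  fixes s r b :: real
  assumes "0 < s" "r / 2 \<le> s" "s \<le> r"
  shows "s powr b \<le> 2 powr \<bar>b\<bar> * r powr b"
proof (cases "0 \<le> b")
  case True
  have "s powr b \<le> r powr b" using assms True by (intro powr_mono2) auto
  also have "\<dots> \<le> 2 powr \<bar>b\<bar> * r powr b" by (simp add: mult_le_cancel_right1 ge_one_powr_ge_zero)
  finally show ?thesis .
next
  case False
  have "s powr b \<le> (r / 2) powr b" using assms False by (intro powr_mono2') auto
  also have "\<dots> = 2 powr \<bar>b\<bar> * r powr b"
    using assms False by (simp add: powr_divide powr_minus field_simps)
  finally show ?thesis .
qed

text \<open>Dyadic decomposition, with \<beta> = 1/2 for the origin and \<beta> = 2 for infinity. On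
  the k-th shell the integrand is comparable to \<beta>^(kb), and the shell lies in a ball of volume
  proportional to \<beta>^(kn), where n is the dimension. The series is geometric with ratio
  \<beta>^(b+n).\<close>

lemma set_integrable_norm_powr:
  fixes S :: "'a::euclidean_space set" and \<beta> b :: real
  assumes [measurable]: "S \<in> sets borel" and \<beta>: "0 < \<beta>" "\<beta> powr (b + DIM('a)) < 1"
    and shell: "\<And>z. z \<in> S \<Longrightarrow> z \<noteq> 0 \<Longrightarrow> \<exists>k::nat. \<beta> ^ k / 2 \<le> norm z \<and> norm z \<le> \<beta> ^ k"
  shows "set_integrable lborel S (\<lambda>z. norm z powr b)"
proof -
  define c where "c k = 2 powr \<bar>b\<bar> * (\<beta> ^ k) powr b" for k :: nat
  define v where "v = unit_ball_vol (DIM('a))"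
  define f where "f z = indicator S z * norm z powr b" for z :: 'a
  have c0: "0 \<le> c k" for k by (simp add: c_def)
  have v0: "0 \<le> v" by (simp add: v_def)
  have f: "f \<in> borel_measurable lborel" unfolding f_def by measurable
  have le: "ennreal (f z) \<le> (\<Sum>k. ennreal (c k) * indicator (cball 0 (\<beta> ^ k)) z)" for z
  proof (cases "z \<in> S \<and> z \<noteq> 0")
    case True
    then obtain k where k: "\<beta> ^ k / 2 \<le> norm z" "norm z \<le> \<beta> ^ k"
      using shell by blast
    have "ennreal (f z) \<le> ennreal (c k) * indicator (cball 0 (\<beta> ^ k)) z"
      using powr_le_dyadic[OF _ k] True k by (auto simp: f_def c_def intro!: ennreal_leI)
    also have "\<dots> = (\<Sum>k\<in>{k}. ennreal (c k) * indicator (cball 0 (\<beta> ^ k)) z)"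
      by (simp del: sum_mult_indicator)
    also have "\<dots> \<le> (\<Sum>k. ennreal (c k) * indicator (cball 0 (\<beta> ^ k)) z)"
      by (rule sum_le_suminf) auto
    finally show ?thesis .
  qed (auto simp: f_def)
  have geo: "c k * (v * (\<beta> ^ k) ^ DIM('a)) = 2 powr \<bar>b\<bar> * v * (\<beta> powr (b + DIM('a))) ^ k" for k
  proof -
    have "(\<beta> ^ k) powr b * (\<beta> ^ k) ^ DIM('a) = (\<beta> ^ k) powr (b + DIM('a))"
      using \<beta> by (simp add: powr_add powr_realpow)
    also have "\<dots> = (\<beta> powr (b + DIM('a))) ^ k"
      using \<beta> by (simp add: powr_powr mult.commute flip: powr_realpow)
    finally show ?thesis by (simp add: c_def)
  qed
  have "(\<integral>\<^sup>+z. f z \<partial>lborel) \<le> (\<integral>\<^sup>+z. (\<Sum>k. ennreal (c k) * indicator (cball (0::'a) (\<beta> ^ k)) z) \<partial>lborel)"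
    by (intro nn_integral_mono le)
  also have "\<dots> = (\<Sum>k. ennreal (c k) * emeasure lborel (cball (0::'a) (\<beta> ^ k)))"
    by (subst nn_integral_suminf)
      (auto simp: nn_integral_cmult_indicator intro!: borel_measurable_times_ennreal borel_measurable_indicator)
  also have "\<dots> = (\<Sum>k. ennreal (c k * (v * (\<beta> ^ k) ^ DIM('a))))"
    using \<beta> c0 v0 by (subst emeasure_cball) (auto simp: ennreal_mult' v_def)
  also have "\<dots> = ennreal (\<Sum>k. 2 powr \<bar>b\<bar> * v * (\<beta> powr (b + DIM('a))) ^ k)"
    unfolding geo using \<beta> v0 by (intro suminf_ennreal2 summable_mult summable_geometric) auto
  also have "\<dots> < \<infinity>" by simp
  finally have "integrable lborel f"
    by (intro integrableI_nonneg f) (auto simp: f_def)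
  then show ?thesis by (simp add: set_integrable_def f_def[abs_def])
qed

lemma set_integrable_norm_powr_cball:
  fixes b :: real
  assumes "- DIM('a::euclidean_space) < b"
  shows "set_integrable lborel (cball (0::'a) 1) (\<lambda>z. norm z powr b)"
proof (rule set_integrable_norm_powr[where \<beta> = "1 / 2"])
  show "(1 / 2 :: real) powr (b + DIM('a)) < 1"
    using assms powr_less_mono2_neg[of "- (b + DIM('a))" 1 2] by (simp add: powr_divide powr_minus field_simps)
  fix z :: 'a assume z: "z \<in> cball 0 1" "z \<noteq> 0"
  define k where "k = (LEAST j::nat. (1 / 2) ^ j < norm z)"
  obtain j :: nat where "(1 / 2) ^ j < norm z"
    using real_arch_pow_inv[of "norm z" "1/2"] z by auto
  then have k: "(1 / 2) ^ k < norm z" unfolding k_def by (rule LeastI)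
  then obtain l where l: "k = Suc l" using z by (cases k) auto
  have "\<not> (1 / 2) ^ l < norm z"
    using not_less_Least[of l "\<lambda>j. (1 / 2) ^ j < norm z"] l by (simp add: k_def)
  with k l show "\<exists>k::nat. (1 / 2) ^ k / 2 \<le> norm z \<and> norm z \<le> (1 / 2) ^ k"
    by (intro exI[of _ l]) auto
qed auto

lemma set_integrable_norm_powr_outside:
  fixes b :: real
  assumes "b < - DIM('a::euclidean_space)"
  shows "set_integrable lborel {z::'a. 1 < norm z} (\<lambda>z. norm z powr b)"
proof (rule set_integrable_norm_powr[where \<beta> = 2])
  show "2 powr (b + DIM('a)) < 1"
    using assms powr_less_mono[of "b + DIM('a)" 0 2] by simp
  fix z :: 'a assume z: "z \<in> {z. 1 < norm z}" "z \<noteq> 0"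
  define k where "k = (LEAST j::nat. norm z < 2 ^ j)"
  obtain j :: nat where "norm z < 2 ^ j"
    using real_arch_pow[of 2 "norm z"] by auto
  then have k: "norm z < 2 ^ k" unfolding k_def by (rule LeastI)
  then obtain l where l: "k = Suc l" using z by (cases k) auto
  have "\<not> norm z < 2 ^ l"
    using not_less_Least[of l "\<lambda>j. norm z < 2 ^ j"] l by (simp add: k_def)
  with k l show "\<exists>k::nat. 2 ^ k / 2 \<le> norm z \<and> norm z \<le> 2 ^ k"
    by (intro exI[of _ k]) auto
qed auto

text \<open>The size of a second difference with step z, up to constants: quadratic for small z by
  Taylor's formula, and governed by the growth |z|^(2a) for large z.\<close>

definition sdiff_maj :: "real \<Rightarrow> 'a::real_normed_vector \<Rightarrow> real" where
  "sdiff_maj a z = (if norm z \<le> 1 then (norm z)\<^sup>2 else norm z powr (2 * a))"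

lemma sdiff_maj_nonneg: "0 \<le> sdiff_maj a z"
  by (simp add: sdiff_maj_def)

text \<open>Integrability at the origin is the condition \<sigma> < 1, integrability at infinity the
  condition a < \<sigma>.\<close>

lemma integrable_sdiff_maj:
  fixes \<sigma> a :: real
  assumes "a < \<sigma>" "\<sigma> < 1"
  shows "integrable lborel (\<lambda>z::real ^ 'n::finite. sdiff_maj a z / norm z powr (CARD('n) + 2 * \<sigma>))"
proof -
  let ?N = "CARD('n) + 2 * \<sigma>"
  have 1: "set_integrable lborel (cball (0::real ^ 'n) 1) (\<lambda>z. norm z powr (2 - ?N))"
    by (rule set_integrable_norm_powr_cball) (use assms in simp)
  have 2: "set_integrable lborel {z::real ^ 'n. 1 < norm z} (\<lambda>z. norm z powr (2 * a - ?N))"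
    by (rule set_integrable_norm_powr_outside) (use assms in simp)
  have "indicat_real (cball 0 1) z * norm z powr (2 - ?N) +
      indicat_real {z. 1 < norm z} z * norm z powr (2 * a - ?N) = sdiff_maj a z / norm z powr ?N"
    for z :: "real ^ 'n"
    by (auto simp: sdiff_maj_def powr_diff indicator_def)
  then show ?thesis
    using Bochner_Integration.integrable_add[OF 1[unfolded set_integrable_def] 2[unfolded set_integrable_def]]
    by simp
qed

text \<open>The negative of the usual symmetric second difference. Its quadratic cancellation at z =
  0 turns the principal value into an absolutely convergent integral.\<close>

definition sdiff :: "('a::real_vector \<Rightarrow> real) \<Rightarrow> 'a \<Rightarrow> 'a \<Rightarrow> real" where
  "sdiff f x z = 2 * f x - f (x + z) - f (x - z)"

lemma wt_powr_add_le:
  assumes "0 \<le> a"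
  shows "wt (x + z) powr a \<le> 2 powr a * wt x powr a * wt z powr a"
proof -
  have "wt (x + z) powr a \<le> (2 * wt x * wt z) powr a"
    using assms by (intro powr_mono2 wt_add_le) (auto simp: less_imp_le)
  then show ?thesis by (simp add: powr_mult less_imp_le)
qed

text \<open>The constant is 10 = 2 * 5, since \<open>wt z\<close> is at most 5 for such z.\<close>

lemma wt_powr_shift_le:
  assumes "0 \<le> a" "norm z \<le> 2"
  shows "wt (x + z) powr a \<le> 10 powr a * wt x powr a"
proof -
  have "(norm z)\<^sup>2 \<le> 2\<^sup>2" using assms by (intro power_mono) auto
  then have "wt z \<le> 5" by (simp add: wt_def)
  then have "2 * wt x * wt z \<le> 2 * wt x * 5"
    by (intro mult_left_mono) (auto simp: less_imp_le)
  then have "wt (x + z) \<le> 10 * wt x" using wt_add_le[of x z] by linarith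
  then have "wt (x + z) powr a \<le> (10 * wt x) powr a"
    using assms by (intro powr_mono2) (auto simp: less_imp_le)
  then show ?thesis by (simp add: powr_mult less_imp_le)
qed

lemma growth_partial2_bound:
  fixes f :: "real ^ 'n::finite \<Rightarrow> real"
  assumes "growth a (Suc (Suc k)) f"
  obtains C where "0 \<le> C" "\<And>i j x. \<bar>partial_deriv i (partial_deriv j f) x\<bar> \<le> C * wt x powr a"
proof -
  have "wt_bdd a (partial_deriv i (partial_deriv j f))" for i j
    using assms growth_wt_bdd growth.simps(2) by blast
  then have "\<exists>C. 0 \<le> C \<and> (\<forall>x. \<bar>partial_deriv i (partial_deriv j f) x\<bar> \<le> C * wt x powr a)" for i j
    by (meson wt_bddE)
  then obtain C where C: "\<And>i j. 0 \<le> C i j"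
      "\<And>i j x. \<bar>partial_deriv i (partial_deriv j f) x\<bar> \<le> C i j * wt x powr a"
    by metis
  let ?S = "\<Sum>i\<in>UNIV. \<Sum>j\<in>UNIV. C i j"
  show thesis
  proof (rule that)
    show "0 \<le> ?S" by (intro sum_nonneg C)
    fix i j x
    have "C i j \<le> (\<Sum>j\<in>UNIV. C i j)" by (rule member_le_sum) (auto simp: C)
    also have "\<dots> \<le> ?S" by (rule member_le_sum) (auto simp: C intro: sum_nonneg)
    finally show "\<bar>partial_deriv i (partial_deriv j f) x\<bar> \<le> ?S * wt x powr a"
      by (intro order_trans[OF C(2)] mult_right_mono) auto
  qed
qed

lemma
  assumes "\<And>x. f differentiable (at x)"
  shows differentiable_translate: "(\<lambda>x. f (x + z)) differentiable (at x)"
    and partial_deriv_translate: "partial_deriv i (\<lambda>x. f (x + z)) x = partial_deriv i f (x + z)"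
    and differentiable_translate_diff: "(\<lambda>x. f (x - z)) differentiable (at x)"
    and partial_deriv_translate_diff: "partial_deriv i (\<lambda>x. f (x - z)) x = partial_deriv i f (x - z)"
  using differentiable_affine_compose[of f z 1 x] partial_deriv_affine_compose[of f z 1 x i]
    differentiable_affine_compose[of f "- z" 1 x] partial_deriv_affine_compose[of f "- z" 1 x i] assms
  by (auto simp: add.commute)

text \<open>For small z the second difference is a difference of differences, and two mean value
  estimates bring in the second derivatives. For large z the three values are bounded one by one.
  The dependence on x is isolated in the single factor \<open>wt x powr a\<close>.\<close>

lemma sdiff_bound:
  fixes f :: "real ^ 'n::finite \<Rightarrow> real"
  assumes f: "growth a (Suc (Suc k)) f" and "0 \<le> a"
  obtains C where "0 \<le> C" "\<And>x z. \<bar>sdiff f x z\<bar> \<le> C * wt x powr a * sdiff_maj a z"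
proof -
  obtain C1 where C1: "0 \<le> C1" "\<And>x. \<bar>f x\<bar> \<le> C1 * wt x powr a"
    using growth_wt_bdd[OF f] by (meson wt_bddE)
  obtain C2 where C2: "0 \<le> C2" "\<And>i j x. \<bar>partial_deriv i (partial_deriv j f) x\<bar> \<le> C2 * wt x powr a"
    using growth_partial2_bound[OF f] by metis
  let ?C = "max ((CARD('n))\<^sup>2 * C2 * 10 powr a) (C1 * (2 + 2 * 4 powr a))"
  have in_le: "\<bar>sdiff f x z\<bar> \<le> (CARD('n))\<^sup>2 * C2 * 10 powr a * wt x powr a * (norm z)\<^sup>2"
    if z: "norm z \<le> 1" for x z
  proof -
    define B where "B = C2 * (10 powr a * wt x powr a)"
    \<comment> \<open>The second difference equals \<open>h x - h (x + z)\<close>. The ball of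
      radius 1 around x contains both x and \<open>x + z\<close>; the translates by
      \<open>- z\<close> in the inner estimate stay in the ball of radius 2.\<close>
    define h where "h y = f y - f (y - z)" for y
    have df: "f differentiable (at y)" "partial_deriv i f differentiable (at y)" for y i
      using f by auto
    have dh: "h differentiable (at y)" for y
      unfolding h_def by (intro differentiable_diff df differentiable_translate_diff)
    have ph: "partial_deriv i h y = partial_deriv i f y - partial_deriv i f (y - z)" for i y
      unfolding h_def[abs_def]
      by (simp add: partial_deriv_diff df differentiable_translate_diff partial_deriv_translate_diff)
    have "\<bar>h x - h (x + z)\<bar> \<le> CARD('n) * (CARD('n) * B * norm z) * norm (x - (x + z))"
    proof (rule partial_deriv_bound[where S = "cball x 1"])
      fix y i assume y: "y \<in> cball x 1"
      have "\<bar>partial_deriv i f y - partial_deriv i f (y - z)\<bar> \<le> CARD('n) * B * norm (y - (y - z))"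
      proof (rule partial_deriv_bound[where S = "cball x 2"])
        show "y \<in> cball x 2" using y by simp
        have "dist x (y - z) \<le> dist x y + norm z"
          using dist_triangle[of x "y - z" y] by (simp add: dist_norm)
        then show "y - z \<in> cball x 2" using y z by simp
        fix w j assume "w \<in> cball x 2"
        then have "norm (w - x) \<le> 2" by (simp add: dist_norm norm_minus_commute)
        from wt_powr_shift_le[OF \<open>0 \<le> a\<close> this, of x]
        have "C2 * wt w powr a \<le> B"
          unfolding B_def by (intro mult_left_mono C2) simp
        then show "\<bar>partial_deriv j (partial_deriv i f) w\<bar> \<le> B"
          using C2(2)[of j i w] by linarith
      qed (use df in auto)
      then show "\<bar>partial_deriv i h y\<bar> \<le> CARD('n) * B * norm z" by (simp add: ph)
    qed (use dh z in \<open>auto simp: dist_norm\<close>)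
    moreover have "sdiff f x z = h x - h (x + z)"
      by (simp add: sdiff_def h_def)
    ultimately show ?thesis
      by (simp add: B_def power2_eq_square mult_ac)
  qed
  have out_le: "\<bar>sdiff f x z\<bar> \<le> C1 * (2 + 2 * 4 powr a) * wt x powr a * norm z powr (2 * a)"
    if z: "1 < norm z" for x z
  proof -
    have "1 \<le> (norm z)\<^sup>2" using z by (simp add: one_le_power)
    then have "wt z \<le> 2 * (norm z)\<^sup>2" by (simp add: wt_def)
    then have "wt z powr a \<le> (2 * (norm z)\<^sup>2) powr a"
      using \<open>0 \<le> a\<close> by (intro powr_mono2) (auto simp: less_imp_le)
    also have "\<dots> = 2 powr a * norm z powr (2 * a)"
    proof -
      have "(norm z)\<^sup>2 = norm z powr 2" using z by simp
      then show ?thesis by (simp add: powr_mult powr_powr del: powr_numeral)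
    qed
    finally have wz: "wt z powr a \<le> 2 powr a * norm z powr (2 * a)" .
    have b: "\<bar>f (x + y)\<bar> \<le> C1 * 4 powr a * wt x powr a * norm z powr (2 * a)" if "norm y = norm z" for y
    proof -
      have "\<bar>f (x + y)\<bar> \<le> C1 * (2 powr a * wt x powr a * wt z powr a)"
        using C1(2)[of "x + y"] mult_left_mono[OF wt_powr_add_le[OF \<open>0 \<le> a\<close>, of x y] C1(1)] that
        by (simp add: wt_def)
      also have "\<dots> \<le> C1 * (2 powr a * wt x powr a * (2 powr a * norm z powr (2 * a)))"
        by (intro mult_left_mono wz C1) auto
      also have "\<dots> = C1 * (2 powr a * 2 powr a) * wt x powr a * norm z powr (2 * a)"
        by (simp add: mult_ac)
      also have "2 powr a * 2 powr a = (4::real) powr a" by (simp flip: powr_mult)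
      finally show ?thesis .
    qed
    have "C1 * wt x powr a * 1 \<le> C1 * wt x powr a * norm z powr (2 * a)"
      using z \<open>0 \<le> a\<close> C1(1) by (intro mult_left_mono ge_one_powr_ge_zero) auto
    then have "\<bar>f x\<bar> \<le> C1 * wt x powr a * norm z powr (2 * a)"
      using C1(2)[of x] by linarith
    moreover have "\<bar>sdiff f x z\<bar> \<le> 2 * \<bar>f x\<bar> + \<bar>f (x + z)\<bar> + \<bar>f (x - z)\<bar>"
      unfolding sdiff_def by linarith
    moreover note b[of z] b[of "- z"]
    ultimately show ?thesis by (simp add: algebra_simps)
  qed
  show thesis
  proof (rule that)
    show "0 \<le> ?C" using C1 C2 by (simp add: le_max_iff_disj)
    fix x z :: "real ^ 'n"
    have m: "c * wt x powr a * t \<le> ?C * wt x powr a * t"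
      if "c \<le> ?C" "0 \<le> t" for c t
      using that by (intro mult_right_mono) auto
    show "\<bar>sdiff f x z\<bar> \<le> ?C * wt x powr a * sdiff_maj a z"
    proof (cases "norm z \<le> 1")
      case True
      have "\<bar>sdiff f x z\<bar> \<le> ?C * wt x powr a * (norm z)\<^sup>2"
        by (rule order_trans[OF in_le[OF True] m]) auto
      then show ?thesis using True by (simp add: sdiff_maj_def)
    next
      case False
      then have z: "1 < norm z" by simp
      have "\<bar>sdiff f x z\<bar> \<le> ?C * wt x powr a * norm z powr (2 * a)"
        by (rule order_trans[OF out_le[OF z] m]) auto
      then show ?thesis using False by (simp add: sdiff_maj_def)
    qed
  qed
qed

section \<open>Smoothness of the fractional Laplacian\<close>

text \<open>The symmetrised form of the fractional Laplacian. The factor 1/2 is due to each pair x +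
  z, x - z being counted twice when z runs over the whole space.\<close>

definition fl :: "real \<Rightarrow> (real ^ 'n::finite \<Rightarrow> real) \<Rightarrow> real ^ 'n \<Rightarrow> real" where
  "fl \<sigma> f x = frac_laplacian_const CARD('n) \<sigma> *
     ((LINT z|lborel. sdiff f x z / norm z powr (real CARD('n) + 2 * \<sigma>)) / 2)"

lemma borel_measurable_growth:
  assumes "growth a (Suc k) f"
  shows "f \<in> borel_measurable borel"
proof -
  have "f differentiable_on UNIV" using assms by (simp add: differentiable_on_UNIV)
  then show ?thesis
    by (intro borel_measurable_continuous_onI differentiable_imp_continuous_on)
qed

lemma integrable_sdiff:
  fixes f :: "real ^ 'n::finite \<Rightarrow> real" and \<sigma> a :: real
  assumes f: "growth a (Suc (Suc k)) f" and "0 \<le> a" "a < \<sigma>" "\<sigma> < 1"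
  shows "integrable lborel (\<lambda>z. sdiff f x z / norm z powr (real CARD('n) + 2 * \<sigma>))"
proof -
  obtain C where C: "0 \<le> C" "\<And>x z. \<bar>sdiff f x z\<bar> \<le> C * wt x powr a * sdiff_maj a z"
    using sdiff_bound[OF f \<open>0 \<le> a\<close>] by metis
  note [measurable] = borel_measurable_growth[OF f]
  show ?thesis
  proof (rule Bochner_Integration.integrable_bound)
    show "integrable lborel (\<lambda>z::real ^ 'n. C * wt x powr a * (sdiff_maj a z / norm z powr (real CARD('n) + 2 * \<sigma>)))"
      by (intro integrable_mult_right integrable_sdiff_maj assms)
    show "(\<lambda>z. sdiff f x z / norm z powr (real CARD('n) + 2 * \<sigma>)) \<in> borel_measurable lborel"
      unfolding sdiff_def by measurable
    have "\<bar>sdiff f x z\<bar> / norm z powr (real CARD('n) + 2 * \<sigma>) \<le>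
        C * wt x powr a * sdiff_maj a z / norm z powr (real CARD('n) + 2 * \<sigma>)" for z
      by (intro divide_right_mono C) auto
    then show "AE z in lborel. norm (sdiff f x z / norm z powr (real CARD('n) + 2 * \<sigma>)) \<le>
        norm (C * wt x powr a * (sdiff_maj a z / norm z powr (real CARD('n) + 2 * \<sigma>)))"
      using C(1) by (auto simp: abs_mult sdiff_maj_nonneg)
  qed
qed

lemma
  fixes f :: "real ^ 'n::finite \<Rightarrow> real"
  assumes "\<And>x. f differentiable (at x)"
  shows differentiable_sdiff: "(\<lambda>x. sdiff f x z) differentiable (at x)"
    and partial_deriv_sdiff: "partial_deriv i (\<lambda>x. sdiff f x z) x = sdiff (partial_deriv i f) x z"
proof -
  note d = differentiable_translate[OF assms] differentiable_translate_diff[OF assms]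
  have d2: "(\<lambda>x. 2 * f x) differentiable (at x)" for x
    by (intro differentiable_mult differentiable_const assms)
  show "(\<lambda>x. sdiff f x z) differentiable (at x)"
    unfolding sdiff_def by (intro differentiable_diff d d2)
  show "partial_deriv i (\<lambda>x. sdiff f x z) x = sdiff (partial_deriv i f) x z"
    unfolding sdiff_def
    by (simp add: partial_deriv_diff d d2 assms partial_deriv_cmult partial_deriv_translate
        partial_deriv_translate_diff)
qed

text \<open>Taylor's formula is applied to \<open>x \<mapsto> sdiff f x z\<close> for fixed \<open>z\<close>, whose second partial
  derivatives are again second differences and hence dominated by \<open>sdiff_maj\<close>. The error estimate
  therefore survives integration over \<open>z\<close>.\<close>

lemma fl_has_derivative:
  fixes f :: "real ^ 'n::finite \<Rightarrow> real" and \<sigma> a :: real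
  assumes f: "growth a 4 f" and a: "0 \<le> a" "a < \<sigma>" "\<sigma> < 1"
  shows "(fl \<sigma> f has_derivative (\<lambda>h. \<Sum>i\<in>UNIV. h $ i * fl \<sigma> (partial_deriv i f) x)) (at x)"
proof -
  let ?N = "real CARD('n) + 2 * \<sigma>"
  define c where "c = frac_laplacian_const CARD('n) \<sigma> / 2"
  have fl: "fl \<sigma> g y = c * (LINT z|lborel. sdiff g y z / norm z powr ?N)" for g :: "real ^ 'n \<Rightarrow> real" and y
    by (simp add: fl_def c_def)
  define M where "M = (LINT z|lborel. sdiff_maj a (z::real ^ 'n) / norm z powr ?N)"
  \<comment> \<open>Four orders are used: two for Taylor's formula in x, and two more to bound the
    second differences of the resulting second partial derivatives.\<close>
  have f4: "growth a (Suc (Suc (Suc (Suc 0)))) f" using f by (simp add: eval_nat_numeral)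
  then have f3: "growth a (Suc (Suc (Suc 0))) (partial_deriv i f)" 
    and f2: "growth a (Suc (Suc 0)) (partial_deriv i (partial_deriv j f))" for i j
    by simp_all
  have d: "f differentiable (at y)" "partial_deriv i f differentiable (at y)" for y i
    using f4 by simp_all
  have "\<exists>C. 0 \<le> C \<and> (\<forall>y z. \<bar>sdiff (partial_deriv i (partial_deriv j f)) y z\<bar> \<le> C * wt y powr a * sdiff_maj a z)" for i j
    using sdiff_bound[OF f2 a(1)] by metis
  then obtain C where C: "\<And>i j. 0 \<le> C i j"
      "\<And>i j y z. \<bar>sdiff (partial_deriv i (partial_deriv j f)) y z\<bar> \<le> C i j * wt y powr a * sdiff_maj a z"
    by metis
  define S where "S = (\<Sum>i\<in>UNIV. \<Sum>j\<in>UNIV. C i j)"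
  have S0: "0 \<le> S" unfolding S_def by (intro sum_nonneg C)
  have CS: "C i j \<le> S" for i j
  proof -
    have "C i j \<le> (\<Sum>j\<in>UNIV. C i j)" by (rule member_le_sum) (auto simp: C)
    also have "\<dots> \<le> S" unfolding S_def by (rule member_le_sum) (auto simp: C intro: sum_nonneg)
    finally show ?thesis .
  qed
  \<comment> \<open>The factor n^2 is that of Taylor's formula, S dominates the constants of all
    pairs of indices, and \<open>10 powr a\<close> pays for moving the weight from a nearby point
    back to x.\<close>
  define A where "A = (CARD('n))\<^sup>2 * (S * (10 powr a * wt x powr a))"
  have A0: "0 \<le> A" using S0 by (simp add: A_def)
  have taylor: "\<bar>sdiff f (x + h) z - sdiff f x z - (\<Sum>i\<in>UNIV. h $ i * sdiff (partial_deriv i f) x z)\<bar>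
      \<le> A * (norm h)\<^sup>2 * sdiff_maj a z" if h: "norm h \<le> 1" for h z
  proof -
    have p: "partial_deriv i (\<lambda>x. sdiff f x z) = (\<lambda>x. sdiff (partial_deriv i f) x z)" for i
      by (intro ext partial_deriv_sdiff d)
    have "\<bar>sdiff f (x + h) z - sdiff f x z - (\<Sum>i\<in>UNIV. h $ i * partial_deriv i (\<lambda>x. sdiff f x z) x)\<bar>
        \<le> (CARD('n))\<^sup>2 * (S * (10 powr a * wt x powr a) * sdiff_maj a z) * (norm h)\<^sup>2"
    proof (rule partial_deriv_taylor)
      show "(\<lambda>x. sdiff f x z) differentiable at y" for y
        by (intro differentiable_sdiff d)
      show "partial_deriv i (\<lambda>x. sdiff f x z) differentiable at y" for i y
        unfolding p by (intro differentiable_sdiff d)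
      fix y i j assume "y \<in> cball x (norm h)"
      then have "norm (y - x) \<le> 2" using h by (simp add: dist_norm norm_minus_commute)
      from wt_powr_shift_le[OF a(1) this, of x]
      have "wt y powr a \<le> 10 powr a * wt x powr a" by simp
      then have "C i j * wt y powr a * sdiff_maj a z \<le> S * (10 powr a * wt x powr a) * sdiff_maj a z"
        by (intro mult_right_mono mult_mono CS S0 sdiff_maj_nonneg) auto
      with C(2)[of i j y z]
      show "\<bar>partial_deriv i (partial_deriv j (\<lambda>x. sdiff f x z)) y\<bar> \<le> S * (10 powr a * wt x powr a) * sdiff_maj a z"
        unfolding p by (subst partial_deriv_sdiff) (use d in auto)
    qed
    then show ?thesis unfolding p A_def by (simp add: mult_ac)
  qed
  have int: "integrable lborel (\<lambda>z. sdiff f y z / norm z powr ?N)"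
    "integrable lborel (\<lambda>z. sdiff (partial_deriv i f) y z / norm z powr ?N)" for y i
    using integrable_sdiff[OF f4 a] integrable_sdiff[OF f3 a] by auto
  have est: "\<bar>fl \<sigma> f (x + h) - fl \<sigma> f x - (\<Sum>i\<in>UNIV. h $ i * fl \<sigma> (partial_deriv i f) x)\<bar>
      \<le> \<bar>c\<bar> * A * M * (norm h)\<^sup>2" if h: "norm h \<le> 1" for h
  proof -
    define r where "r z = (sdiff f (x + h) z - sdiff f x z -
        (\<Sum>i\<in>UNIV. h $ i * sdiff (partial_deriv i f) x z)) / norm z powr ?N" for z
    have r: "r z = sdiff f (x + h) z / norm z powr ?N - sdiff f x z / norm z powr ?N -
        (\<Sum>i\<in>UNIV. h $ i * (sdiff (partial_deriv i f) x z / norm z powr ?N))" for z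
      by (simp add: r_def diff_divide_distrib sum_divide_distrib)
    have "(LINT z|lborel. r z) = (LINT z|lborel. sdiff f (x + h) z / norm z powr ?N) -
        (LINT z|lborel. sdiff f x z / norm z powr ?N) -
        (\<Sum>i\<in>UNIV. h $ i * (LINT z|lborel. sdiff (partial_deriv i f) x z / norm z powr ?N))"
      unfolding r
      by (simp add: int Bochner_Integration.integral_diff Bochner_Integration.integral_sum
          Bochner_Integration.integrable_diff Bochner_Integration.integrable_sum
          del: times_divide_eq_right)
    then have "fl \<sigma> f (x + h) - fl \<sigma> f x - (\<Sum>i\<in>UNIV. h $ i * fl \<sigma> (partial_deriv i f) x) =
        c * (LINT z|lborel. r z)"
      unfolding fl by (simp add: right_diff_distrib sum_distrib_left mult.left_commute)
    moreover have "\<bar>LINT z|lborel. r z\<bar> \<le> (LINT z|lborel. A * (norm h)\<^sup>2 * (sdiff_maj a (z::real ^ 'n) / norm z powr ?N))"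
    proof (rule integral_abs_bound_integral)
      show "integrable lborel r"
        unfolding r[abs_def] by (intro Bochner_Integration.integrable_diff Bochner_Integration.integrable_sum
            integrable_mult_right int)
      show "integrable lborel (\<lambda>z::real ^ 'n. A * (norm h)\<^sup>2 * (sdiff_maj a z / norm z powr ?N))"
        by (intro integrable_mult_right integrable_sdiff_maj a)
      show "\<bar>r z\<bar> \<le> A * (norm h)\<^sup>2 * (sdiff_maj a z / norm z powr ?N)" for z
        unfolding r_def using divide_right_mono[OF taylor[OF h, of z], of "norm z powr ?N"] by simp
    qed
    then have "\<bar>LINT z|lborel. r z\<bar> \<le> A * (norm h)\<^sup>2 * M"
      unfolding M_def by (simp only: integral_mult_right_zero)
    then have "\<bar>c * (LINT z|lborel. r z)\<bar> \<le> \<bar>c\<bar> * (A * (norm h)\<^sup>2 * M)"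
      unfolding abs_mult by (rule mult_left_mono) simp
    ultimately show ?thesis by (simp add: mult_ac)
  qed
  show ?thesis
  proof (rule has_derivativeI_sandwich[where e = 1 and H = "\<lambda>y. \<bar>c\<bar> * A * M * norm (y - x)"])
    show "bounded_linear (\<lambda>h. \<Sum>i\<in>UNIV. h $ i * fl \<sigma> (partial_deriv i f) x)"
      by (intro bounded_linear_sum bounded_linear_mult_const bounded_linear_vec_nth)
    show "((\<lambda>y. \<bar>c\<bar> * A * M * norm (y - x)) \<longlongrightarrow> 0) (at x)"
      by (auto intro!: tendsto_eq_intros)
    fix y assume "y \<noteq> x" "dist y x < 1"
    then show "norm (fl \<sigma> f y - fl \<sigma> f x - (\<Sum>i\<in>UNIV. (y - x) $ i * fl \<sigma> (partial_deriv i f) x)) / norm (y - x)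
        \<le> \<bar>c\<bar> * A * M * norm (y - x)"
      using est[of "y - x"] by (simp add: dist_norm divide_le_eq power2_eq_square mult_ac)
  qed simp
qed

lemma
  fixes f :: "real ^ 'n::finite \<Rightarrow> real"
  assumes f: "\<And>k. growth a k f" and a: "0 \<le> a" "a < \<sigma>" "\<sigma> < 1"
  shows differentiable_fl: "fl \<sigma> f differentiable (at x)"
    and partial_deriv_fl: "partial_deriv i (fl \<sigma> f) x = fl \<sigma> (partial_deriv i f) x"
  using fl_has_derivative[OF f a, of x] partial_deriv_has_derivative_sum
  by (auto simp: differentiable_def)

lemma growth_partial_deriv: "(\<And>k. growth a k f) \<Longrightarrow> growth a k (partial_deriv i f)"
  using growth.simps(2) by blast

text \<open>Partial derivatives of f have the same weight a, and the operator commutes with them, so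
  the induction runs over all f of the class simultaneously.\<close>

lemma C_k_fl:
  assumes "\<And>k. growth a k f" and a: "0 \<le> a" "a < \<sigma>" "\<sigma> < 1"
  shows "C_k k (fl \<sigma> f)"
  using assms(1)
proof (induction k arbitrary: f)
  case 0
  have "fl \<sigma> f differentiable_on UNIV"
    using differentiable_fl[OF 0 a] by (simp add: differentiable_on_UNIV)
  then show ?case by (simp add: differentiable_imp_continuous_on)
next
  case (Suc k)
  have "partial_deriv i (fl \<sigma> f) = fl \<sigma> (partial_deriv i f)" for i
    using partial_deriv_fl[OF Suc.prems a] by auto
  moreover have "C_k k (fl \<sigma> (partial_deriv i f))" for i
    by (intro Suc.IH growth_partial_deriv Suc.prems)
  ultimately show ?case
    using differentiable_fl[OF Suc.prems a] by (simp add: differentiable_on_UNIV)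
qed

section \<open>Principal values, linearity and scaling\<close>

lemma lborel_distr_reflect:
  fixes x :: "'a::euclidean_space"
  shows "distr lborel borel (\<lambda>z. x - z) = lborel"
  using lborel_affine[of "-1" x] by (simp add: density_1)

text \<open>Dominated convergence with |s| itself as majorant. At the origin, which the truncation
  removes, the limit is correct because s vanishes there.\<close>

lemma tendsto_integral_punctured:
  fixes s :: "'a::euclidean_space \<Rightarrow> real"
  assumes s: "integrable lborel s" and "s 0 = 0"
  shows "((\<lambda>\<epsilon>. LINT z|lborel. indicator {z. \<epsilon> < norm z} z * s z) \<longlongrightarrow> (LINT z|lborel. s z)) (at_right 0)"
  unfolding tendsto_at_iff_sequentially comp_def
proof (intro allI impI)
  fix X :: "nat \<Rightarrow> real" assume X: "X \<longlonglongrightarrow> 0"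
  have [measurable]: "s \<in> borel_measurable lborel" using s by auto
  show "(\<lambda>i. LINT z|lborel. indicator {z. X i < norm z} z * s z) \<longlonglongrightarrow> (LINT z|lborel. s z)"
  proof (rule integral_dominated_convergence[where w = "\<lambda>z. norm (s z)"])
    show "AE z in lborel. (\<lambda>i. indicator {z. X i < norm z} z * s z) \<longlonglongrightarrow> s z"
    proof (intro always_eventually allI)
      fix z :: 'a
      show "(\<lambda>i. indicator {z. X i < norm z} z * s z) \<longlonglongrightarrow> s z"
      proof (cases "z = 0")
        case False
        then have "\<forall>\<^sub>F i in sequentially. X i < norm z"
          using order_tendstoD(2)[OF X, of "norm z"] by simp
        then have "\<forall>\<^sub>F i in sequentially. s z = indicator {z. X i < norm z} z * s z"
          by eventually_elim simp
        then show ?thesis by (rule Lim_transform_eventually[OF tendsto_const])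
      qed (simp add: \<open>s 0 = 0\<close>)
    qed
    show "AE z in lborel. norm (indicator {z. X i < norm z} z * s z) \<le> norm (s z)" for i
      by (auto simp: indicator_def)
  qed (use s in auto)
qed

text \<open>The substitutions y = x + z and y = x - z express the truncated integral in two ways.
  Their average is half the truncated integral of the second difference, which is absolutely
  integrable up to the origin, so the truncation can be removed.\<close>

lemma has_frac_laplacian_fl:
  fixes f :: "real ^ 'n::finite \<Rightarrow> real" and \<sigma> a :: real
  assumes f: "growth a (Suc (Suc k)) f" and a: "0 \<le> a" "a < \<sigma>" "\<sigma> < 1"
  shows "has_frac_laplacian \<sigma> f x (fl \<sigma> f x)"
proof -
  let ?N = "real CARD('n) + 2 * \<sigma>"
  define G where "G \<epsilon> y = indicator {y. \<epsilon> < norm (x - y)} y * ((f x - f y) / norm (x - y) powr ?N)" for \<epsilon> y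
  define s where "s z = sdiff f x z / norm z powr ?N" for z
  obtain C where C: "0 \<le> C" "\<And>x. \<bar>f x\<bar> \<le> C * wt x powr a"
    using growth_wt_bdd[OF f] by (meson wt_bddE)
  note [measurable] = borel_measurable_growth[OF f]
  have G[measurable]: "G \<epsilon> \<in> borel_measurable borel" for \<epsilon>
    unfolding G_def by measurable
  have plus: "distr lborel borel (\<lambda>z. x + z) = lborel" by (rule lborel_distr_plus)
  have intp: "integrable lborel (\<lambda>z. G \<epsilon> (x + z))" if "0 < \<epsilon>" for \<epsilon>
  proof (rule Bochner_Integration.integrable_bound)
    \<comment> \<open>The part \<open>C * wt x powr a * (1 + 2 powr a)\<close> comes from bounding f
      at x and at x + z. The rest compares \<open>wt z powr a\<close> with the majorant outside the
      ball of radius \<epsilon>, where |z|^2 / \<epsilon>^2 \<ge> 1.\<close>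
    define K where "K = C * wt x powr a * (1 + 2 powr a) * (2 powr a * (1 + 1 / \<epsilon>\<^sup>2))"
    have K0: "0 \<le> K" using C(1) by (simp add: K_def)
    show "integrable lborel (\<lambda>z::real ^ 'n. K * (sdiff_maj a z / norm z powr ?N))"
      by (intro integrable_mult_right integrable_sdiff_maj a)
    have wz: "wt z powr a \<le> 2 powr a * (1 + 1 / \<epsilon>\<^sup>2) * sdiff_maj a z" if z: "\<epsilon> < norm z" for z :: "real ^ 'n"
    proof (cases "norm z \<le> 1")
      case True
      then have "(norm z)\<^sup>2 \<le> 1" by (simp add: power_le_one)
      then have "wt z powr a \<le> 2 powr a * 1"
        using a by (auto intro!: powr_mono2 simp: wt_def)
      also have "1 \<le> (1 + 1 / \<epsilon>\<^sup>2) * (norm z)\<^sup>2"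
      proof -
        have "\<epsilon>\<^sup>2 \<le> (norm z)\<^sup>2" using z \<open>0 < \<epsilon>\<close> by (intro power_mono) auto
        then have "1 \<le> 1 / \<epsilon>\<^sup>2 * (norm z)\<^sup>2" using \<open>0 < \<epsilon>\<close> by (simp add: field_simps)
        then show ?thesis by (simp add: distrib_right add_increasing)
      qed
      finally show ?thesis using True by (simp add: sdiff_maj_def mult_ac)
    next
      case False
      then have "1 \<le> (norm z)\<^sup>2" by (simp add: one_le_power)
      then have "wt z powr a \<le> (2 * (norm z)\<^sup>2) powr a"
        using a by (intro powr_mono2) (auto simp: less_imp_le wt_def)
      also have "\<dots> = 2 powr a * norm z powr (2 * a)"
      proof -
        have "(norm z)\<^sup>2 = norm z powr 2" using False by simp
        then show ?thesis by (simp add: powr_mult powr_powr del: powr_numeral)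
      qed
      also have "\<dots> \<le> 2 powr a * ((1 + 1 / \<epsilon>\<^sup>2) * norm z powr (2 * a))"
        by (intro mult_left_mono) (auto simp: distrib_right)
      finally show ?thesis using False by (simp add: sdiff_maj_def mult_ac)
    qed
    have num: "\<bar>f x - f (x + z)\<bar> \<le> K * sdiff_maj a z" if z: "\<epsilon> < norm z" for z
    proof -
      have "\<bar>f (x + z)\<bar> \<le> C * (2 powr a * wt x powr a * wt z powr a)"
        using C(2)[of "x + z"] mult_left_mono[OF wt_powr_add_le[OF a(1), of x z] C(1)] by linarith
      moreover have "C * wt x powr a * 1 \<le> C * wt x powr a * wt z powr a"
        using a C(1) by (intro mult_left_mono ge_one_powr_ge_zero) auto
      moreover have "\<bar>f x - f (x + z)\<bar> \<le> \<bar>f x\<bar> + \<bar>f (x + z)\<bar>" by linarith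
      ultimately have "\<bar>f x - f (x + z)\<bar> \<le> C * wt x powr a * (1 + 2 powr a) * wt z powr a"
        using C(2)[of x] by (simp add: algebra_simps)
      also have "\<dots> \<le> C * wt x powr a * (1 + 2 powr a) * (2 powr a * (1 + 1 / \<epsilon>\<^sup>2) * sdiff_maj a z)"
        using C(1) by (intro mult_left_mono wz[OF z]) auto
      finally show ?thesis by (simp add: K_def mult_ac)
    qed
    have "norm (G \<epsilon> (x + z)) \<le> K * (sdiff_maj a z / norm z powr ?N)" for z
    proof (cases "\<epsilon> < norm z")
      case True
      then show ?thesis
        using divide_right_mono[OF num[OF True], of "norm z powr ?N"] by (simp add: G_def)
    next
      case False
      then show ?thesis using K0 by (simp add: G_def sdiff_maj_nonneg)
    qed
    then show "AE z in lborel. norm (G \<epsilon> (x + z)) \<le> norm (K * (sdiff_maj a z / norm z powr ?N))"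
      unfolding real_norm_def by (intro always_eventually allI order_trans[OF _ abs_ge_self])
  qed measurable
  then have int: "integrable lborel (G \<epsilon>)" if "0 < \<epsilon>" for \<epsilon>
    using that integrable_distr_eq[of "\<lambda>z. x + z" lborel borel "G \<epsilon>"] by (simp add: plus)
  have intm: "integrable lborel (\<lambda>z. G \<epsilon> (x - z))" if "0 < \<epsilon>" for \<epsilon>
    using int[OF that] integrable_distr_eq[of "\<lambda>z. x - z" lborel borel "G \<epsilon>"]
    by (simp add: lborel_distr_reflect)
  have sym: "(LINT y|lborel. G \<epsilon> y) = (LINT z|lborel. indicator {z. \<epsilon> < norm z} z * s z) / 2" if "0 < \<epsilon>" for \<epsilon>
  proof -
    have "(LINT y|lborel. G \<epsilon> y) = (LINT z|lborel. G \<epsilon> (x + z))"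
      using integral_distr[of "\<lambda>z. x + z" lborel borel "G \<epsilon>"] by (simp add: plus)
    moreover have "(LINT y|lborel. G \<epsilon> y) = (LINT z|lborel. G \<epsilon> (x - z))"
      using integral_distr[of "\<lambda>z. x - z" lborel borel "G \<epsilon>"] by (simp add: lborel_distr_reflect)
    ultimately have "2 * (LINT y|lborel. G \<epsilon> y) = (LINT z|lborel. G \<epsilon> (x + z) + G \<epsilon> (x - z))"
      using intp[OF that] intm[OF that] by simp
    also have "(\<lambda>z. G \<epsilon> (x + z) + G \<epsilon> (x - z)) = (\<lambda>z. indicator {z. \<epsilon> < norm z} z * s z)"
      by (auto simp: fun_eq_iff G_def s_def sdiff_def indicator_def simp flip: add_divide_distrib)
    finally show ?thesis by simp
  qed
  have "((\<lambda>\<epsilon>. frac_laplacian_const CARD('n) \<sigma> * (LINT y|lborel. G \<epsilon> y)) \<longlongrightarrow> fl \<sigma> f x) (at_right 0)"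
  proof (rule Lim_transform_eventually)
    have "integrable lborel s" unfolding s_def by (rule integrable_sdiff[OF f a])
    \<comment> \<open>The denominator is \<open>0 powr _ = 0\<close>, and division by 0 yields
      0.\<close>
    moreover have "s 0 = 0" by (simp add: s_def)
    ultimately show "((\<lambda>\<epsilon>. frac_laplacian_const CARD('n) \<sigma> *
        ((LINT z|lborel. indicator {z. \<epsilon> < norm z} z * s z) / 2)) \<longlongrightarrow> fl \<sigma> f x) (at_right 0)"
      unfolding fl_def s_def[symmetric] by (intro tendsto_intros tendsto_integral_punctured) auto
    show "\<forall>\<^sub>F \<epsilon> in at_right 0. frac_laplacian_const CARD('n) \<sigma> *
        ((LINT z|lborel. indicator {z. \<epsilon> < norm z} z * s z) / 2) =
        frac_laplacian_const CARD('n) \<sigma> * (LINT y|lborel. G \<epsilon> y)"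
      using eventually_at_right_less[of 0] by eventually_elim (simp add: sym)
  qed
  with int show ?thesis
    by (simp add: has_frac_laplacian_def set_integrable_def set_lebesgue_integral_def G_def[abs_def])
qed

section \<open>Linearity and scaling of the fractional Laplacian\<close>

lemma has_frac_laplacian_add:
  assumes "has_frac_laplacian \<sigma> f x L" "has_frac_laplacian \<sigma> g x M"
  shows "has_frac_laplacian \<sigma> (\<lambda>x. f x + g x) x (L + M)"
proof -
  let ?k = "\<lambda>f y. (f x - f y) / norm (x - y) powr (real CARD('a) + 2 * \<sigma>)"
  have eq: "?k (\<lambda>x. f x + g x) y = ?k f y + ?k g y" for y
    by (simp add: diff_divide_distrib add_divide_distrib)
  have i: "set_integrable lborel {y. \<epsilon> < norm (x - y)} (?k f)"
    "set_integrable lborel {y. \<epsilon> < norm (x - y)} (?k g)" if "0 < \<epsilon>" for \<epsilon>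
    using assms that by (auto simp: has_frac_laplacian_def)
  have "((\<lambda>\<epsilon>. frac_laplacian_const CARD('a) \<sigma> * (LINT y:{y. \<epsilon> < norm (x - y)}|lborel. ?k f y) +
      frac_laplacian_const CARD('a) \<sigma> * (LINT y:{y. \<epsilon> < norm (x - y)}|lborel. ?k g y)) \<longlongrightarrow> L + M) (at_right 0)"
    using assms by (auto simp: has_frac_laplacian_def intro!: tendsto_add)
  moreover have "\<forall>\<^sub>F \<epsilon> in at_right 0.
      frac_laplacian_const CARD('a) \<sigma> * (LINT y:{y. \<epsilon> < norm (x - y)}|lborel. ?k f y) +
      frac_laplacian_const CARD('a) \<sigma> * (LINT y:{y. \<epsilon> < norm (x - y)}|lborel. ?k g y) =
      frac_laplacian_const CARD('a) \<sigma> * (LINT y:{y. \<epsilon> < norm (x - y)}|lborel. ?k f y + ?k g y)"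
    using eventually_at_right_less[of 0]
    by eventually_elim (simp add: set_integral_add(2)[OF i] distrib_left)
  ultimately show ?thesis
    unfolding has_frac_laplacian_def eq
    by (auto intro: set_integral_add(1) i Lim_transform_eventually)
qed

lemma has_frac_laplacian_cmult:
  assumes "has_frac_laplacian \<sigma> f x L"
  shows "has_frac_laplacian \<sigma> (\<lambda>x. c * f x) x (c * L)"
proof -
  let ?k = "\<lambda>f y. (f x - f y) / norm (x - y) powr (real CARD('a) + 2 * \<sigma>)"
  have eq: "?k (\<lambda>x. c * f x) y = c * ?k f y" for y
    by (simp add: right_diff_distrib)
  have "((\<lambda>\<epsilon>. c * (frac_laplacian_const CARD('a) \<sigma> * (LINT y:{y. \<epsilon> < norm (x - y)}|lborel. ?k f y)))
      \<longlongrightarrow> c * L) (at_right 0)"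
    using assms by (auto simp: has_frac_laplacian_def intro!: tendsto_intros)
  with assms show ?thesis
    unfolding has_frac_laplacian_def eq
    by (auto simp: mult.left_commute simp del: times_divide_eq_right)
qed

lemma
  fixes H :: "'a::euclidean_space \<Rightarrow> real"
  assumes [measurable]: "H \<in> borel_measurable borel" and c: "0 < c"
  shows integrable_lborel_scaleR: "integrable lborel (\<lambda>y. H (c *\<^sub>R y)) \<longleftrightarrow> integrable lborel H"
    and integral_lborel_scaleR: "(LINT y|lborel. H (c *\<^sub>R y)) = (LINT y|lborel. H y) / c ^ DIM('a)"
proof -
  have L: "(lborel :: 'a measure) = density (distr lborel borel (\<lambda>y. c *\<^sub>R y)) (\<lambda>_. ennreal (c ^ DIM('a)))"
    using lborel_affine[of c "0::'a"] c by simp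
  have "integrable lborel H \<longleftrightarrow> integrable (density (distr lborel borel (\<lambda>y::'a. c *\<^sub>R y)) (\<lambda>_. ennreal (c ^ DIM('a)))) H"
    using L by metis
  also have "\<dots> \<longleftrightarrow> integrable lborel (\<lambda>y. H (c *\<^sub>R y))"
    using c by (subst integrable_density) (auto simp: integrable_distr_eq)
  finally show "integrable lborel (\<lambda>y. H (c *\<^sub>R y)) \<longleftrightarrow> integrable lborel H" ..
  have "(LINT y|lborel. H y) = integral\<^sup>L (density (distr lborel borel (\<lambda>y::'a. c *\<^sub>R y)) (\<lambda>_. ennreal (c ^ DIM('a)))) H"
    using L by metis
  also have "\<dots> = c ^ DIM('a) * (LINT y|lborel. H (c *\<^sub>R y))"
    using c by (subst integral_density) (auto simp: integral_distr)
  finally show "(LINT y|lborel. H (c *\<^sub>R y)) = (LINT y|lborel. H y) / c ^ DIM('a)"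
    using c by simp
qed

text \<open>The substitution turns the truncation radius \<epsilon> into c \<epsilon>. The kernel
  contributes c^(n+2\<sigma>) and the volume element c^(-n), which leaves c^(2\<sigma>).\<close>

lemma has_frac_laplacian_scaleR:
  fixes f :: "real ^ 'n::finite \<Rightarrow> real"
  assumes f: "has_frac_laplacian \<sigma> f (c *\<^sub>R x) L" and c: "0 < c"
    and [measurable]: "f \<in> borel_measurable borel"
  shows "has_frac_laplacian \<sigma> (\<lambda>x. f (c *\<^sub>R x)) x (c powr (2 * \<sigma>) * L)"
proof -
  let ?N = "real CARD('n) + 2 * \<sigma>"
  define H where "H \<epsilon> y = indicator {y. \<epsilon> < norm (c *\<^sub>R x - y)} y *
    ((f (c *\<^sub>R x) - f y) / norm (c *\<^sub>R x - y) powr ?N)" for \<epsilon> y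
  define G where "G \<epsilon> y = indicator {y. \<epsilon> < norm (x - y)} y *
    ((f (c *\<^sub>R x) - f (c *\<^sub>R y)) / norm (x - y) powr ?N)" for \<epsilon> y
  have H[measurable]: "H \<epsilon> \<in> borel_measurable borel" for \<epsilon>
    unfolding H_def by measurable
  have GH: "G \<epsilon> = (\<lambda>y. c powr ?N * H (c * \<epsilon>) (c *\<^sub>R y))" for \<epsilon>
  proof
    fix y
    have "norm (c *\<^sub>R x - c *\<^sub>R y) = c * norm (x - y)"
      using c by (simp flip: scaleR_diff_right)
    then show "G \<epsilon> y = c powr ?N * H (c * \<epsilon>) (c *\<^sub>R y)"
      using c by (simp add: G_def H_def powr_mult indicator_def)
  qed
  have intH: "integrable lborel (H \<epsilon>)" if "0 < \<epsilon>" for \<epsilon>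
    using f that by (simp add: has_frac_laplacian_def set_integrable_def H_def[abs_def])
  then have intG: "integrable lborel (G \<epsilon>)" if "0 < \<epsilon>" for \<epsilon>
    using that c unfolding GH by (intro integrable_mult_right) (simp add: integrable_lborel_scaleR)
  have "(LINT y|lborel. G \<epsilon> y) = c powr (2 * \<sigma>) * (LINT y|lborel. H (c * \<epsilon>) y)" for \<epsilon>
    unfolding GH using c by (simp add: integral_lborel_scaleR powr_add powr_realpow)
  moreover have "((\<lambda>\<epsilon>. c powr (2 * \<sigma>) * (frac_laplacian_const CARD('n) \<sigma> * (LINT y|lborel. H (c * \<epsilon>) y)))
      \<longlongrightarrow> c powr (2 * \<sigma>) * L) (at_right 0)"
  proof (rule tendsto_mult_left)
    have "((\<lambda>\<epsilon>. frac_laplacian_const CARD('n) \<sigma> * (LINT y|lborel. H \<epsilon> y)) \<longlongrightarrow> L) (at_right 0)"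
      using f by (simp add: has_frac_laplacian_def set_lebesgue_integral_def H_def[abs_def])
    moreover have "filterlim (\<lambda>\<epsilon>. c * \<epsilon>) (at_right 0) (at_right 0)"
      unfolding filterlim_at using c eventually_at_right_less[of 0]
      by (auto intro!: tendsto_eq_intros elim: eventually_mono)
    ultimately show "((\<lambda>\<epsilon>. frac_laplacian_const CARD('n) \<sigma> * (LINT y|lborel. H (c * \<epsilon>) y)) \<longlongrightarrow> L) (at_right 0)"
      by (rule filterlim_compose)
  qed
  ultimately show ?thesis
    using intG by (simp add: has_frac_laplacian_def set_integrable_def set_lebesgue_integral_def
        G_def[abs_def] mult.left_commute)
qed

section \<open>Functions vanishing on a half space\<close>

lemma frac_laplacian_const_pos:
  assumes "0 < \<sigma>" "\<sigma> < 1"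
  shows "0 < frac_laplacian_const n \<sigma>"
  unfolding frac_laplacian_const_def using assms
  by (intro divide_pos_pos mult_pos_pos Gamma_real_pos) auto

text \<open>A nonnegative function with integral 0 vanishes almost everywhere, whereas a ball inside
  U has positive measure.\<close>

lemma integral_lborel_pos:
  fixes g :: "'a::euclidean_space \<Rightarrow> real"
  assumes g: "integrable lborel g" "\<And>y. 0 \<le> g y" and "open U" "U \<noteq> {}"
    and pos: "\<And>y. y \<in> U \<Longrightarrow> 0 < g y"
  shows "0 < (LINT y|lborel. g y)"
proof (rule ccontr)
  assume "\<not> 0 < (LINT y|lborel. g y)"
  then have "(LINT y|lborel. g y) = 0"
    using Bochner_Integration.integral_nonneg[of lborel g] g by (simp add: order_antisym)
  then have ae: "AE y in lborel. g y = 0"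
    using integral_nonneg_eq_0_iff_AE[of lborel g] g by simp
  obtain y0 e where e: "0 < e" "ball y0 e \<subseteq> U"
    using assms by (metis ex_in_conv openE)
  from ae have "AE y in lborel. y \<notin> ball y0 e"
    by eventually_elim (use e pos in force)
  then have "emeasure lborel (ball y0 e) = 0"
    using AE_iff_null_sets[of "ball y0 e" lborel] by auto
  then show False
    using e(1) unit_ball_vol_pos[of "real DIM('a)"] by (simp add: emeasure_ball)
qed

lemma DERIV_along_axis:
  fixes f :: "real ^ 'n::finite \<Rightarrow> real"
  assumes "f differentiable (at x)"
  shows "((\<lambda>t. f (x + t *\<^sub>R axis i 1)) has_real_derivative partial_deriv i f x) (at 0)"
proof -
  let ?D = "frechet_derivative f (at x)"
  have D: "(f has_derivative ?D) (at (x + 0 *\<^sub>R axis i 1))"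
    using assms frechet_derivative_works[of f "at x"] by simp
  have "((\<lambda>t. x + t *\<^sub>R axis i (1::real)) has_derivative (\<lambda>t. t *\<^sub>R axis i 1)) (at 0)"
    by (auto intro!: derivative_eq_intros)
  from diff_chain_at[OF this D]
  have "((\<lambda>t. f (x + t *\<^sub>R axis i 1)) has_derivative (\<lambda>t. ?D (t *\<^sub>R axis i 1))) (at 0)"
    by (simp add: o_def)
  moreover have "?D (t *\<^sub>R axis i 1) = partial_deriv i f x * t" for t
    using linear_cmul[OF has_derivative_linear[OF D], of t] by (simp add: partial_deriv_def)
  ultimately show ?thesis by (simp add: has_field_derivative_def)
qed

text \<open>Bernoulli's inequality for a negative exponent; exp (r s) separates the two sides, by 1
  + r s \<le> exp (r s) and ln (1 - s) \<le> - s.\<close>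

lemma one_add_le_powr_minus:
  fixes s r :: real
  assumes "s < 1" "0 \<le> r"
  shows "1 + r * s \<le> (1 - s) powr (- r)"
proof -
  have "1 + r * s \<le> exp (r * s)" by (rule exp_ge_add_one_self)
  also have "r * s \<le> - r * ln (1 - s)"
    using mult_left_mono[OF ln_le_minus_one[of "1 - s"], of r] assms by simp
  then have "exp (r * s) \<le> (1 - s) powr (- r)" using assms by (simp add: powr_def)
  finally show ?thesis .
qed

text \<open>Since f vanishes near x, the truncated integral does not depend on \<epsilon> once
  \<epsilon> is below the distance from x to the hyperplane. The principal value is then an ordinary
  integral against a kernel that is nonsingular where f lives.\<close>

lemma fl_halfspace:
  fixes f :: "real ^ 'n::finite \<Rightarrow> real" and \<sigma> a b :: real
  assumes f: "growth a (Suc (Suc k)) f" and a: "0 \<le> a" "a < \<sigma>" "\<sigma> < 1"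
    and zero: "\<And>y. y $ i \<le> b \<Longrightarrow> f y = 0" and x: "x $ i < b"
  shows "integrable lborel (\<lambda>y. f y / norm (x - y) powr (real CARD('n) + 2 * \<sigma>))" (is ?I)
    and "fl \<sigma> f x = - frac_laplacian_const CARD('n) \<sigma> *
      (LINT y|lborel. f y / norm (x - y) powr (real CARD('n) + 2 * \<sigma>))" (is ?L)
proof -
  let ?N = "real CARD('n) + 2 * \<sigma>"
  let ?J = "LINT y|lborel. f y / norm (x - y) powr ?N"
  define \<epsilon>0 where "\<epsilon>0 = b - x $ i"
  have h: "has_frac_laplacian \<sigma> f x (fl \<sigma> f x)" by (rule has_frac_laplacian_fl[OF f a])
  have fx: "f x = 0" using zero x by simp
  have eq: "indicator {y. \<epsilon> < norm (x - y)} y *\<^sub>R ((f x - f y) / norm (x - y) powr ?N) = - (f y / norm (x - y) powr ?N)"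
    if "\<epsilon> \<le> \<epsilon>0" for \<epsilon> y
  proof (cases "\<epsilon> < norm (x - y)")
    case False
    have "\<bar>(y - x) $ i\<bar> \<le> norm (y - x)" by (rule component_le_norm_cart)
    then have "y $ i \<le> b" using False that by (simp add: \<epsilon>0_def norm_minus_commute)
    then show ?thesis using False zero by simp
  qed (simp add: fx)
  have "0 < \<epsilon>0" using x by (simp add: \<epsilon>0_def)
  then have "set_integrable lborel {y. \<epsilon>0 < norm (x - y)} (\<lambda>y. (f x - f y) / norm (x - y) powr ?N)"
    using h by (simp add: has_frac_laplacian_def)
  then have "integrable lborel (\<lambda>y. - (f y / norm (x - y) powr ?N))"
    unfolding set_integrable_def by (simp only: eq order_refl)
  from Bochner_Integration.integrable_minus[OF this] show ?I by simp
  have "((\<lambda>\<epsilon>. frac_laplacian_const CARD('n) \<sigma> *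
      (LINT y:{y. \<epsilon> < norm (x - y)}|lborel. (f x - f y) / norm (x - y) powr ?N)) \<longlongrightarrow> fl \<sigma> f x) (at_right 0)"
    using h by (simp add: has_frac_laplacian_def)
  moreover have "\<forall>\<^sub>F \<epsilon> in at_right 0. \<epsilon> < \<epsilon>0"
    using \<open>0 < \<epsilon>0\<close> by (rule order_tendstoD(2)[OF tendsto_ident_at])
  then have "\<forall>\<^sub>F \<epsilon> in at_right 0. frac_laplacian_const CARD('n) \<sigma> *
      (LINT y:{y. \<epsilon> < norm (x - y)}|lborel. (f x - f y) / norm (x - y) powr ?N) =
      frac_laplacian_const CARD('n) \<sigma> * (- ?J)"
    unfolding set_lebesgue_integral_def by eventually_elim (simp only: eq[OF less_imp_le] Bochner_Integration.integral_minus)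
  ultimately have "((\<lambda>\<epsilon>::real. frac_laplacian_const CARD('n) \<sigma> * (- ?J)) \<longlongrightarrow> fl \<sigma> f x) (at_right 0)"
    by (rule Lim_transform_eventually)
  then show ?L
    by (simp add: tendsto_const_iff)
qed

text \<open>The sign is that of minus an integral of a positive function. For the derivative, a
  small step of x along the axis brings x closer to every point of the half space, so the kernel
  increases there. A lower bound for this increase that is linear in the step controls the
  difference quotient, without differentiating the kernel under the integral.\<close>

lemma fl_halfspace_neg:
  fixes f :: "real ^ 'n::finite \<Rightarrow> real" and \<sigma> a b :: real
  assumes f: "\<And>k. growth a k f" and a: "0 \<le> a" "a < \<sigma>" "\<sigma> < 1"
    and zero: "\<And>y. y $ i \<le> b \<Longrightarrow> f y = 0" and pos: "\<And>y. b < y $ i \<Longrightarrow> 0 < f y"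
    and x: "x $ i \<le> b - 1"
  shows "fl \<sigma> f x < 0" and "partial_deriv i (fl \<sigma> f) x < 0"
proof -
  let ?N = "real CARD('n) + 2 * \<sigma>"
  let ?U = "{y::real ^ 'n. b < y $ i}"
  define c where "c = frac_laplacian_const CARD('n) \<sigma>"
  define J where "J x = (LINT y|lborel. f y / norm (x - y) powr ?N)" for x
  have c: "0 < c" unfolding c_def by (rule frac_laplacian_const_pos) (use a in auto)
  have f0: "0 \<le> f y" for y using zero[of y] pos[of y] by (cases "y $ i \<le> b") auto
  note [measurable] = borel_measurable_growth[OF f]
  have int: "integrable lborel (\<lambda>y. f y / norm (x - y) powr ?N)"
    and fl: "fl \<sigma> f x = - c * J x" if "x $ i < b" for x
    using fl_halfspace[OF f a zero that] by (auto simp: c_def J_def)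
  have U: "open ?U" by (rule open_halfspace_component_gt_cart)
  have "(\<chi> j. b + 1) \<in> ?U" by simp
  then have U0: "?U \<noteq> {}" by blast
  have d1: "1 \<le> norm (x - y)" if "y \<in> ?U" for y
    using component_le_norm_cart[of "x - y" i] x that by simp
  have xb: "x $ i < b" using x by simp
  have "0 < J x"
    unfolding J_def
  proof (rule integral_lborel_pos[OF int[OF xb] _ U U0])
    show "0 < f y / norm (x - y) powr ?N" if "y \<in> ?U" for y
    proof -
      have "0 < norm (x - y)" "0 < f y" using d1[OF that] pos that by auto
      then show ?thesis by (intro divide_pos_pos) auto
    qed
  qed (use f0 in auto)
  then show "fl \<sigma> f x < 0" using fl[OF xb] c by simp
  \<comment> \<open>With d = |x - y| and N = \<open>?N\<close>, the derivative of d^(-N) along the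
    axis is N d^(-N-2) (y_i - x_i), at least N d^(-N-2) since y_i - x_i \<ge> 1. Half of this is
    kept: the other half absorbs the t^2 in the squared distance after a step t < 1.\<close>
  define g where "g y = f y / norm (x - y) powr ?N * (?N / 2 / (norm (x - y))\<^sup>2)" for y
  define \<kappa> where "\<kappa> = (LINT y|lborel. g y)"
  have g: "integrable lborel g"
  proof (rule Bochner_Integration.integrable_bound)
    show "integrable lborel (\<lambda>y. (?N / 2) * (f y / norm (x - y) powr ?N))"
      by (intro integrable_mult_right int xb)
    show "g \<in> borel_measurable lborel" unfolding g_def by measurable
    have "\<bar>g y\<bar> \<le> \<bar>(?N / 2) * (f y / norm (x - y) powr ?N)\<bar>" for y
    proof (cases "y \<in> ?U")
      case True
      have "1 \<le> (norm (x - y))\<^sup>2" using d1[OF True] by (simp add: one_le_power)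
      then have "?N / 2 / (norm (x - y))\<^sup>2 \<le> ?N / 2 / 1"
        using a by (intro divide_left_mono) auto
      then have "f y / norm (x - y) powr ?N * (?N / 2 / (norm (x - y))\<^sup>2) \<le>
          f y / norm (x - y) powr ?N * (?N / 2 / 1)"
        using f0 by (intro mult_left_mono) auto
      then have "g y \<le> (?N / 2) * (f y / norm (x - y) powr ?N)"
        unfolding g_def by (simp only: div_by_1 mult.commute)
      moreover have "0 \<le> g y" using f0 a by (simp add: g_def)
      ultimately show ?thesis by linarith
    next
      case False
      then show ?thesis using zero by (simp add: g_def)
    qed
    then show "AE y in lborel. norm (g y) \<le> norm ((?N / 2) * (f y / norm (x - y) powr ?N))"
      by simp
  qed
  have \<kappa>: "0 < \<kappa>"
    unfolding \<kappa>_def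
  proof (rule integral_lborel_pos[OF g _ U U0])
    show "0 \<le> g y" for y using f0 a by (simp add: g_def)
    show "0 < g y" if "y \<in> ?U" for y
    proof -
      have "0 < norm (x - y)" "0 < f y" using d1[OF that] pos that by auto
      then show ?thesis using a unfolding g_def by (intro mult_pos_pos divide_pos_pos) auto
    qed
  qed
  have incr: "J x + t * \<kappa> \<le> J (x + t *\<^sub>R axis i 1)" if t: "0 < t" "t < 1" for t
  proof -
    let ?x = "x + t *\<^sub>R axis i 1"
    have xt: "?x $ i < b" using x t by (simp add: axis_def)
    have "f y / norm (x - y) powr ?N + t * g y \<le> f y / norm (?x - y) powr ?N" for y
    proof (cases "y \<in> ?U")
      case True
      define d where "d = norm (x - y)"
      define d' where "d' = norm (?x - y)"
      have d: "1 \<le> d" using d1[OF True] by (simp add: d_def)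
      have "\<bar>(?x - y) $ i\<bar> \<le> d'" unfolding d'_def by (rule component_le_norm_cart)
      then have d'0: "0 < d'" using xt True by auto
      have "d'\<^sup>2 = d\<^sup>2 + 2 * t * (x $ i - y $ i) + t\<^sup>2"
        unfolding d_def d'_def power2_norm_eq_inner
        by (simp add: inner_add_left inner_add_right inner_diff_left inner_diff_right inner_commute
            inner_axis power2_eq_square algebra_simps)
      also have "\<dots> \<le> d\<^sup>2 - t"
      proof -
        have "t * (x $ i - y $ i) \<le> t * (- 1)" using t x True by (intro mult_left_mono) auto
        moreover have "t\<^sup>2 \<le> t" using t by (simp add: power2_eq_square mult_le_cancel_left1)
        ultimately show ?thesis by simp
      qed
      finally have dd: "d'\<^sup>2 \<le> d\<^sup>2 * (1 - t / d\<^sup>2)" using d by (simp add: right_diff_distrib)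
      have s: "t / d\<^sup>2 < 1"
      proof -
        have "0 < d\<^sup>2 * (1 - t / d\<^sup>2)" using d'0 dd by (meson less_le_trans zero_less_power)
        then show ?thesis using d by (simp add: zero_less_mult_iff)
      qed
      have p: "r powr (- ?N) = (r\<^sup>2) powr (- (?N / 2))" if "0 < r" for r :: real
      proof -
        have "r\<^sup>2 = r powr 2" using that by simp
        moreover have "2 * - (?N / 2) = - ?N" by (simp add: field_simps)
        ultimately show ?thesis by (simp only: powr_powr)
      qed
      have "d powr (- ?N) * (1 + ?N / 2 * (t / d\<^sup>2)) \<le> d powr (- ?N) * (1 - t / d\<^sup>2) powr (- (?N / 2))"
        using s a by (intro mult_left_mono one_add_le_powr_minus) auto
      also have "\<dots> = (d\<^sup>2 * (1 - t / d\<^sup>2)) powr (- (?N / 2))"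
      proof -
        have "0 < d" using d by simp
        show ?thesis unfolding p[OF \<open>0 < d\<close>] by (rule powr_mult[symmetric])
      qed
      also have "\<dots> \<le> (d'\<^sup>2) powr (- (?N / 2))"
        using dd d'0 a by (intro powr_mono2') auto
      also have "\<dots> = d' powr (- ?N)" by (rule p[OF d'0, symmetric])
      finally have "f y * (d powr (- ?N) * (1 + ?N / 2 * (t / d\<^sup>2))) \<le> f y * d' powr (- ?N)"
        using f0 by (intro mult_left_mono)
      then show ?thesis
        unfolding g_def d_def[symmetric] d'_def[symmetric] powr_minus divide_inverse
        by (simp add: algebra_simps)
    next
      case False
      then show ?thesis using zero by (simp add: g_def)
    qed
    then have "(LINT y|lborel. f y / norm (x - y) powr ?N + t * g y) \<le> J ?x"
      unfolding J_def by (intro integral_mono Bochner_Integration.integrable_add integrable_mult_right int g xb xt)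
    then show ?thesis
      using int[OF xb] g by (simp add: J_def \<kappa>_def)
  qed
  let ?q = "\<lambda>t. (fl \<sigma> f (x + t *\<^sub>R axis i 1) - fl \<sigma> f x) / t"
  \<comment> \<open>The derivative exists as a two-sided limit; its restriction to t > 0, where the
    monotonicity estimate holds, determines its value.\<close>
  have "(?q \<longlongrightarrow> partial_deriv i (fl \<sigma> f) x) (at 0)"
    using DERIV_along_axis[OF differentiable_fl[OF f a], of x i] by (simp add: DERIV_def)
  then have "(?q \<longlongrightarrow> partial_deriv i (fl \<sigma> f) x) (at_right 0)"
    by (rule tendsto_mono[rotated]) (simp add: at_le)
  moreover have "\<forall>\<^sub>F t in at_right 0. t < (1::real)"
    by (rule order_tendstoD(2)[OF tendsto_ident_at]) simp
  then have "\<forall>\<^sub>F t in at_right 0. ?q t \<le> - (c * \<kappa>)"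
    using eventually_at_right_less[of 0]
  proof eventually_elim
    case (elim t)
    then have t: "0 < t" "t < 1" by auto
    have "(x + t *\<^sub>R axis i 1) $ i < b" using x t by (simp add: axis_def)
    then have "fl \<sigma> f (x + t *\<^sub>R axis i 1) - fl \<sigma> f x = - (c * (J (x + t *\<^sub>R axis i 1) - J x))"
      using fl xb by (simp add: algebra_simps)
    also have "\<dots> \<le> - (c * (t * \<kappa>))"
      using incr[OF t] c by simp
    finally show ?case using t by (simp add: divide_le_eq mult_ac)
  qed
  ultimately have "partial_deriv i (fl \<sigma> f) x \<le> - (c * \<kappa>)"
    by (intro tendsto_upperbound) auto
  then show "partial_deriv i (fl \<sigma> f) x < 0" using c \<kappa> by (smt (verit) mult_pos_pos)
qed

section \<open>Profiles with prescribed decay\<close>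

lemma tendsto_norm_powr_at_infinity:
  fixes s :: real
  assumes "s < 0"
  shows "((\<lambda>x::'a::real_normed_vector. norm x powr s) \<longlongrightarrow> 0) at_infinity"
  using filterlim_compose[OF tendsto_neg_powr[OF assms filterlim_ident] filterlim_norm_at_top] .

lemma eventually_norm_gt_at_infinity: "\<forall>\<^sub>F x::'a::real_normed_vector in at_infinity. r < norm x"
  using filterlim_norm_at_top[where 'a = 'a] unfolding filterlim_at_top_dense by blast

lemma filterlim_scaleR_at_infinity:
  assumes "0 < c"
  shows "filterlim (\<lambda>x::'a::real_normed_vector. c *\<^sub>R x) at_infinity at_infinity"
proof (rule filterlim_norm_at_top_imp_at_infinity)
  show "filterlim (\<lambda>x::'a. norm (c *\<^sub>R x)) at_top at_infinity"
    using filterlim_tendsto_pos_mult_at_top[OF tendsto_const assms filterlim_norm_at_top] assms by simp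
qed

text \<open>Both profiles come from this one function: it cuts off the tail profile inside the unit
  ball, and a power of its complement is the bump.\<close>

definition flat_step :: "'a::real_normed_vector \<Rightarrow> real" where
  "flat_step x = flat 0 ((norm x)\<^sup>2 - 1)"

lemma flat_step_eq_0 [simp]: "norm x \<le> 1 \<Longrightarrow> flat_step x = 0"
  by (simp add: flat_step_def power_le_one)

lemma flat_step_nonneg: "0 \<le> flat_step x"
  by (simp add: flat_step_def flat_nonneg)

lemma flat_step_less_1: "flat_step x < 1"
  by (simp add: flat_step_def flat_def)

lemma growth_flat_step: "growth 0 k (flat_step :: real ^ 'n::finite \<Rightarrow> real)"
  using growth_flat_ball[of 0] by (simp add: flat_step_def[abs_def])

text \<open>With t = |x|^2 - 1, this is 1 - exp (- 1/t) \<le> 1/t together with t \<ge> |x|^2 / 2,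
  valid for |x| \<ge> 2.\<close>

lemma one_minus_flat_step_le:
  assumes "2 \<le> norm x"
  shows "1 - flat_step x \<le> 2 * norm x powr (- 2)"
proof -
  let ?t = "(norm x)\<^sup>2 - 1"
  have "2\<^sup>2 \<le> (norm x)\<^sup>2" using assms by (intro power_mono) auto
  then have t: "0 < ?t" "(norm x)\<^sup>2 / 2 \<le> ?t" by auto
  have "1 - flat_step x \<le> inverse ?t"
    using t exp_ge_add_one_self[of "- inverse ?t"] by (simp add: flat_step_def flat_def)
  also have "\<dots> \<le> inverse ((norm x)\<^sup>2 / 2)"
    using t assms by (intro le_imp_inverse_le) (auto intro: zero_less_power)
  also have "\<dots> = 2 * norm x powr (- 2)"
    using assms by (simp add: powr_minus field_simps)
  finally show ?thesis .
qed

lemma tendsto_flat_step: "(flat_step \<longlongrightarrow> 1) at_infinity"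
proof (rule tendsto_sandwich)
  have "((\<lambda>x::'a. 1 - 2 * norm x powr (- 2)) \<longlongrightarrow> 1 - 2 * 0) at_infinity"
    by (intro tendsto_intros tendsto_norm_powr_at_infinity) simp
  then show "((\<lambda>x::'a. 1 - 2 * norm x powr (- 2)) \<longlongrightarrow> 1) at_infinity" by simp
  show "\<forall>\<^sub>F x::'a in at_infinity. 1 - 2 * norm x powr (- 2) \<le> flat_step x"
    using eventually_norm_gt_at_infinity[of 2]
  proof eventually_elim
    case (elim x)
    then show ?case using one_minus_flat_step_le[of x] by simp
  qed
qed (auto intro!: always_eventually less_imp_le flat_step_less_1)

text \<open>The complement of the step decays only like |x|^(-2); raising it to the power m gives
  any prescribed algebraic decay while keeping it positive.\<close>

lemma tendsto_powr_one_minus_flat_step: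
  assumes "q < 2 * real m"
  shows "((\<lambda>x::'a::real_normed_vector. norm x powr q * (1 - flat_step x) ^ m) \<longlongrightarrow> 0) at_infinity"
proof (rule Lim_null_comparison)
  show "\<forall>\<^sub>F x::'a in at_infinity. norm (norm x powr q * (1 - flat_step x) ^ m) \<le> 2 ^ m * norm x powr (q - 2 * real m)"
    using eventually_norm_gt_at_infinity[of 2]
  proof eventually_elim
    case (elim x)
    have "(1 - flat_step x) ^ m \<le> (2 * norm x powr (- 2)) ^ m"
      using elim flat_step_less_1[of x] by (intro power_mono one_minus_flat_step_le) auto
    also have "\<dots> = 2 ^ m * norm x powr (- 2 * real m)"
    proof -
      have "0 < norm x" using elim by linarith
      then have "0 < norm x powr (- 2)" by simp
      from powr_realpow[OF this, of m] show ?thesis by (simp add: power_mult_distrib powr_powr)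
    qed
    finally have "norm x powr q * (1 - flat_step x) ^ m \<le> norm x powr q * (2 ^ m * norm x powr (- 2 * real m))"
      by (intro mult_left_mono) auto
    also have "\<dots> = 2 ^ m * norm x powr (q - 2 * real m)"
    proof -
      have "norm x powr (q - 2 * real m) = norm x powr q * norm x powr (- 2 * real m)"
        by (simp flip: powr_add)
      then show ?thesis by simp
    qed
    finally show ?case using flat_step_less_1[of x] by (simp add: abs_mult)
  qed
  have "((\<lambda>x::'a. 2 ^ m * norm x powr (q - 2 * real m)) \<longlongrightarrow> 2 ^ m * 0) at_infinity"
    using assms by (intro tendsto_intros tendsto_norm_powr_at_infinity) simp
  then show "((\<lambda>x::'a. 2 ^ m * norm x powr (q - 2 * real m)) \<longlongrightarrow> 0) at_infinity" by simp
qed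

text \<open>Away from the origin the product equals (|x|^(-2) + 1)^(-q/2).\<close>

lemma tendsto_powr_wt:
  "((\<lambda>x::'a::real_inner. norm x powr q * wt x powr (- q / 2)) \<longlongrightarrow> 1) at_infinity"
proof (rule Lim_transform_eventually)
  have "((\<lambda>x::'a. (norm x powr (- 2) + 1) powr (- q / 2)) \<longlongrightarrow> (0 + 1) powr (- q / 2)) at_infinity"
    by (intro tendsto_intros tendsto_norm_powr_at_infinity) auto
  then show "((\<lambda>x::'a. (norm x powr (- 2) + 1) powr (- q / 2)) \<longlongrightarrow> 1) at_infinity" by simp
  show "\<forall>\<^sub>F x::'a in at_infinity. (norm x powr (- 2) + 1) powr (- q / 2) = norm x powr q * wt x powr (- q / 2)"
    using eventually_norm_gt_at_infinity[of 0]
  proof eventually_elim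
    case (elim x)
    have "wt x = norm x powr 2 * (norm x powr (- 2) + 1)"
      using elim by (simp add: wt_def distrib_left powr_minus)
    then have "wt x powr (- q / 2) = norm x powr (- q) * (norm x powr (- 2) + 1) powr (- q / 2)"
      using elim by (simp add: powr_mult powr_powr del: powr_numeral)
    moreover have "norm x powr q * norm x powr (- q) = 1"
      using elim by (simp flip: powr_add)
    ultimately show ?case by (metis mult.assoc mult_1)
  qed
qed

lemma tendsto_powr_flat_step_wt:
  "((\<lambda>x::'a::real_inner. norm x powr q * (flat_step x * wt x powr (- q / 2))) \<longlongrightarrow> 1) at_infinity"
proof -
  have "((\<lambda>x::'a. flat_step x * (norm x powr q * wt x powr (- q / 2))) \<longlongrightarrow> 1 * 1) at_infinity"
    by (intro tendsto_mult tendsto_flat_step tendsto_powr_wt)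
  then show ?thesis by (simp add: mult_ac)
qed

lemma tendsto_powr_flat_halfspace:
  fixes i :: "'n::finite"
  assumes "q < 2 * M"
  shows "((\<lambda>x::real ^ 'n. norm x powr q * (flat 0 (x $ i - b) * wt x powr (- M))) \<longlongrightarrow> 0) at_infinity"
proof (rule Lim_null_comparison)
  have "((\<lambda>x::real ^ 'n. norm x powr (q - 2 * M) * (norm x powr (2 * M) * wt x powr (- (2 * M) / 2))) \<longlongrightarrow> 0 * 1) at_infinity"
    using assms by (intro tendsto_mult tendsto_powr_wt tendsto_norm_powr_at_infinity) simp
  then show "((\<lambda>x::real ^ 'n. norm x powr (q - 2 * M) * (norm x powr (2 * M) * wt x powr (- M))) \<longlongrightarrow> 0) at_infinity"
    by simp
  show "\<forall>\<^sub>F x::real ^ 'n in at_infinity. norm (norm x powr q * (flat 0 (x $ i - b) * wt x powr (- M)))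
      \<le> norm x powr (q - 2 * M) * (norm x powr (2 * M) * wt x powr (- M))"
  proof (intro always_eventually allI)
    fix x :: "real ^ 'n"
    have "flat 0 (x $ i - b) * (norm x powr q * wt x powr (- M)) \<le> 1 * (norm x powr q * wt x powr (- M))"
      using flat_le_fact[of 0] by (intro mult_right_mono) auto
    moreover have "norm x powr q = norm x powr (q - 2 * M) * norm x powr (2 * M)"
      by (simp flip: powr_add)
    ultimately have "norm x powr q * (flat 0 (x $ i - b) * wt x powr (- M))
        \<le> norm x powr (q - 2 * M) * (norm x powr (2 * M) * wt x powr (- M))"
      by (simp only: mult_1 mult.assoc mult.left_commute)
    then show "norm (norm x powr q * (flat 0 (x $ i - b) * wt x powr (- M)))
      \<le> norm x powr (q - 2 * M) * (norm x powr (2 * M) * wt x powr (- M))"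
      by (simp add: flat_nonneg)
  qed
qed

lemma tendsto_powr_scaleR:
  fixes f :: "'a::real_normed_vector \<Rightarrow> real"
  assumes "((\<lambda>x. norm x powr q * f x) \<longlongrightarrow> L) at_infinity" "0 < c"
  shows "((\<lambda>x. norm x powr q * f (c *\<^sub>R x)) \<longlongrightarrow> c powr (- q) * L) at_infinity"
proof -
  have "((\<lambda>x. c powr (- q) * (norm (c *\<^sub>R x) powr q * f (c *\<^sub>R x))) \<longlongrightarrow> c powr (- q) * L) at_infinity"
    using filterlim_compose[OF assms(1) filterlim_scaleR_at_infinity[OF assms(2)]]
    by (intro tendsto_mult_left)
  then show ?thesis
    using assms(2) by (simp add: powr_mult powr_minus field_simps)
qed

section \<open>Uniform bounds on compact sets\<close>

lemma C2_bounded_compact: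
  fixes \<Phi> :: "real ^ 'n::finite \<Rightarrow> real"
  assumes \<Phi>: "C_k 2 \<Phi>" and "compact S"
  obtains M where "0 \<le> M" "\<And>x. x \<in> S \<Longrightarrow> \<bar>\<Phi> x\<bar> \<le> M"
    "\<And>x i. x \<in> S \<Longrightarrow> \<bar>partial_deriv i \<Phi> x\<bar> \<le> M"
    "\<And>x i j. x \<in> S \<Longrightarrow> \<bar>partial_deriv i (partial_deriv j \<Phi>) x\<bar> \<le> M"
proof -
  have c: "continuous_on S \<Phi>" "continuous_on S (partial_deriv i \<Phi>)"
    "continuous_on S (partial_deriv i (partial_deriv j \<Phi>))" for i j
  proof -
    have d: "\<Phi> differentiable_on UNIV" "partial_deriv i \<Phi> differentiable_on UNIV"
      "continuous_on UNIV (partial_deriv i (partial_deriv j \<Phi>))"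
      using \<Phi> by (auto simp: numeral_2_eq_2)
    show "continuous_on S \<Phi>" "continuous_on S (partial_deriv i \<Phi>)"
      "continuous_on S (partial_deriv i (partial_deriv j \<Phi>))"
      using d(3)[THEN continuous_on_subset] d(1,2)[THEN differentiable_imp_continuous_on, THEN continuous_on_subset]
      by auto
  qed
  \<comment> \<open>One continuous function dominates the value and all derivatives up to order 2,
    so a single compactness argument bounds them together.\<close>
  define F where "F x = \<bar>\<Phi> x\<bar> + (\<Sum>i\<in>UNIV. \<bar>partial_deriv i \<Phi> x\<bar>) +
    (\<Sum>i\<in>UNIV. \<Sum>j\<in>UNIV. \<bar>partial_deriv i (partial_deriv j \<Phi>) x\<bar>)" for x
  have "continuous_on S F" unfolding F_def by (intro continuous_intros c)
  then have "bounded (F ` S)" using \<open>compact S\<close> by (intro compact_imp_bounded compact_continuous_image)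
  then obtain M where M: "0 < M" "\<And>x. x \<in> S \<Longrightarrow> \<bar>F x\<bar> \<le> M"
    by (auto simp: bounded_pos)
  have 1: "\<bar>partial_deriv i \<Phi> x\<bar> \<le> (\<Sum>i\<in>UNIV. \<bar>partial_deriv i \<Phi> x\<bar>)" for i x
    by (rule member_le_sum) auto
  have 2: "\<bar>partial_deriv i (partial_deriv j \<Phi>) x\<bar> \<le> (\<Sum>i\<in>UNIV. \<Sum>j\<in>UNIV. \<bar>partial_deriv i (partial_deriv j \<Phi>) x\<bar>)" for i j x
  proof -
    have "\<bar>partial_deriv i (partial_deriv j \<Phi>) x\<bar> \<le> (\<Sum>j\<in>UNIV. \<bar>partial_deriv i (partial_deriv j \<Phi>) x\<bar>)"
      by (rule member_le_sum) auto
    also have "\<dots> \<le> (\<Sum>i\<in>UNIV. \<Sum>j\<in>UNIV. \<bar>partial_deriv i (partial_deriv j \<Phi>) x\<bar>)"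
      by (rule member_le_sum) (auto intro: sum_nonneg)
    finally show ?thesis .
  qed
  have 3: "0 \<le> (\<Sum>i\<in>UNIV. \<bar>partial_deriv i \<Phi> x\<bar>)"
    "0 \<le> (\<Sum>i\<in>UNIV. \<Sum>j\<in>UNIV. \<bar>partial_deriv i (partial_deriv j \<Phi>) x\<bar>)" for x
    by (auto intro!: sum_nonneg)
  have FM: "F x \<le> M" if "x \<in> S" for x using M(2)[OF that] by linarith
  show thesis
  proof (rule that[of M])
    fix x assume x: "x \<in> S"
    note b = FM[OF x, unfolded F_def] 3[of x]
    show "\<bar>\<Phi> x\<bar> \<le> M" using b by linarith
    show "\<bar>partial_deriv i \<Phi> x\<bar> \<le> M" for i using b 1[of i x] abs_ge_zero[of "\<Phi> x"] by linarith
    show "\<bar>partial_deriv i (partial_deriv j \<Phi>) x\<bar> \<le> M" for i j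
      using b 2[of i j x] abs_ge_zero[of "\<Phi> x"] by linarith
  qed (use M in simp)
qed

lemma continuous_neg_compact:
  fixes f :: "'a::topological_space \<Rightarrow> real"
  assumes "continuous_on S f" "compact S" "\<And>x. x \<in> S \<Longrightarrow> f x < 0"
  obtains \<kappa> where "0 < \<kappa>" "\<And>x. x \<in> S \<Longrightarrow> f x \<le> - \<kappa>"
proof (cases "S = {}")
  case False
  obtain x0 where "x0 \<in> S" "\<And>x. x \<in> S \<Longrightarrow> f x \<le> f x0"
    using continuous_attains_sup[OF assms(2) False assms(1)] by blast
  then show thesis using that[of "- f x0"] assms(3) by auto
qed (use that[of 1] in simp)

text \<open>The shape is preserved and each derivative multiplies the scaled coefficients by c, so
  the same rule also yields the second derivatives.\<close>

lemma partial_deriv_scaled_combination: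
  assumes "\<And>x. f differentiable (at x)" "\<And>x. g differentiable (at x)" "\<And>x. h differentiable (at x)"
  shows "partial_deriv i (\<lambda>x. \<alpha> * f (c *\<^sub>R x) + \<beta> * g (c *\<^sub>R x) + h x) =
        (\<lambda>x. (\<alpha> * c) * partial_deriv i f (c *\<^sub>R x) + (\<beta> * c) * partial_deriv i g (c *\<^sub>R x) + partial_deriv i h x)"
proof -
  have s: "(\<lambda>x. k * F (c *\<^sub>R x)) differentiable (at x)"
    "partial_deriv i (\<lambda>x. k * F (c *\<^sub>R x)) x = (k * c) * partial_deriv i F (c *\<^sub>R x)"
    if "\<And>x. F differentiable (at x)" for F :: "real ^ 'a \<Rightarrow> real" and k x
    using differentiable_affine_compose[of F 0 c x] partial_deriv_affine_compose[of F 0 c x i] that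
    by (auto intro!: differentiable_mult simp: partial_deriv_cmult)
  note d = s(1)[where F = f and k = \<alpha>, OF assms(1)] s(1)[where F = g and k = \<beta>, OF assms(2)]
  show ?thesis
    by (intro ext)
      (simp only: partial_deriv_add[OF differentiable_add[OF d] assms(3)] partial_deriv_add[OF d]
        s(2)[where F = f, OF assms(1)] s(2)[where F = g, OF assms(2)])
qed

lemma norm_vec_le_sum:
  fixes v :: "'a::real_normed_vector ^ 'n::finite"
  assumes "\<And>i. norm (v $ i) \<le> B"
  shows "norm v \<le> real CARD('n) * B"
proof -
  have "norm v \<le> (\<Sum>i\<in>UNIV. norm (v $ i))"
    unfolding norm_vec_def by (rule L2_set_le_sum) simp
  also have "\<dots> \<le> (\<Sum>i\<in>(UNIV::'n set). B)" by (intro sum_mono assms)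
  finally show ?thesis by simp
qed

lemma exists_small_scale:
  fixes \<alpha> \<beta> r s \<delta> :: real
  assumes "0 < r" "0 < s" "0 < \<delta>"
  shows "\<exists>c. 0 < c \<and> c \<le> 1 / 3 \<and> \<alpha> * c powr r \<le> \<delta> \<and> \<beta> * c powr s \<le> \<delta>"
proof -
  have lim: "((\<lambda>c. b * c powr e) \<longlongrightarrow> 0) (at_right 0)" if "0 < e" for b e :: real
  proof -
    have "((\<lambda>c. b * c powr e) \<longlongrightarrow> b * 0 powr e) (at_right 0)"
      using that by (intro tendsto_intros tendsto_powr'
          filterlim_at_split[THEN iffD1, THEN conjunct1] disjI2)
        (auto simp: eventually_at_filter)
    then show ?thesis by simp
  qed
  have "\<forall>\<^sub>F c in at_right 0. c < (1 / 3 :: real)"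
    by (rule order_tendstoD(2)[OF tendsto_ident_at]) simp
  then have "\<forall>\<^sub>F c in at_right 0. 0 < c \<and> c \<le> 1 / 3 \<and> \<alpha> * c powr r \<le> \<delta> \<and> \<beta> * c powr s \<le> \<delta>"
    using eventually_at_right_less[of 0] order_tendstoD(2)[OF lim[OF assms(1)] assms(3), of \<alpha>]
      order_tendstoD(2)[OF lim[OF assms(2)] assms(3), of \<beta>]
    by eventually_elim auto
  then show ?thesis
    using eventually_happens'[of "at_right (0::real)"] by auto
qed

section \<open>The construction\<close>

theorem theorem1p3:
  fixes \<sigma> p q :: real
  assumes "0 < \<sigma>" and "\<sigma> < 1" and "q > - 2 * \<sigma>"
  shows "\<exists>(c::real) (C::real) (K :: real \<Rightarrow> real ^ 'n::finite \<Rightarrow> real) (u :: real \<Rightarrow> real ^ 'n \<Rightarrow> real).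
    0 < c \<and> 0 < C \<and>
    (\<forall>l\<ge>1. C_infinity (K l)) \<and>
    (\<forall>l\<ge>1. \<forall>x\<in>ball 0 2.
        - C \<le> K l x \<and> K l x \<le> - c \<and>
        c \<le> norm (gradient (K l) x) \<and> norm (gradient (K l) x) \<le> C \<and>
        norm (hessian (K l) x) \<le> C) \<and>
    (\<forall>l\<ge>1. C_infinity (u l) \<and> (\<forall>x. 0 < u l x)) \<and>
    (\<forall>l\<ge>1. (\<forall>x. has_frac_laplacian \<sigma> (u l) x (K l x * u l x powr p)) \<and>
        ((\<lambda>x. norm x powr q * u l x) \<longlongrightarrow> 1) at_infinity) \<and>
    filterlim (\<lambda>l. INF x\<in>cball 0 1. u l x) at_top at_top"
proof -
  \<comment> \<open>The tail profile has order \<open>wt x powr (- q / 2)\<close>. The hypothesis on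
    q says -q/2 < \<sigma>, and the maximum with 0 accommodates bounded functions.\<close>
  define a where "a = max 0 (- q / 2)"
  have a: "0 \<le> a" "a < \<sigma>" "\<sigma> < 1" using assms by (auto simp: a_def)
  \<comment> \<open>With 2m > q, both the bump and the half-space bump vanish at infinity after
    multiplication by |x|^q, so only the tail profile contributes to the limit.\<close>
  obtain m :: nat where m: "q < 2 * real m"
    using reals_Archimedean2[of "q / 2"] by (auto simp: field_simps)
  \<comment> \<open>Any coordinate direction serves.\<close>
  define i :: 'n where "i = undefined"
  define A :: "real ^ 'n \<Rightarrow> real" where "A x = (1 - flat_step x) ^ m" for x
  define T :: "real ^ 'n \<Rightarrow> real" where "T x = flat_step x * wt x powr (- q / 2)" for x
  define P :: "real ^ 'n \<Rightarrow> real" where "P x = flat 0 (x $ i - 3) * wt x powr (- real m)" for x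
  have gA: "growth a k A" for k
  proof -
    have "growth 0 k (\<lambda>x::real ^ 'n. (1 + (- 1) * flat_step x) ^ m)"
      by (intro growth_power growth_add growth_cmult growth_const growth_flat_step)
    then show ?thesis using a(1) growth_mono by (auto simp: A_def[abs_def])
  qed
  have gT: "growth a k T" for k
    unfolding T_def[abs_def]
    by (rule growth_mono[OF growth_mult[OF growth_flat_step growth_wt_powr]]) (simp add: a_def)
  have gP: "growth a k P" for k
    unfolding P_def[abs_def]
    by (rule growth_mono[OF growth_mult[OF growth_flat_halfspace growth_wt_powr]]) (use a in simp)
  have A1: "A x = 1" and T0: "T x = 0" if "norm x \<le> 1" for x
    using that by (simp_all add: A_def T_def)
  have A_pos: "0 < A x" for x using flat_step_less_1[of x] by (simp add: A_def)
  have T_nonneg: "0 \<le> T x" and P_nonneg: "0 \<le> P x" for x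
    by (simp_all add: T_def P_def flat_nonneg flat_step_nonneg)
  have P0: "P x = 0" if "x $ i \<le> 3" for x using that by (simp add: P_def)
  have P_pos: "0 < P x" if "3 < x $ i" for x using that by (simp add: P_def flat_pos)
  note meas = borel_measurable_growth[OF gA] borel_measurable_growth[OF gT] borel_measurable_growth[OF gP]
  define \<Phi>A \<Phi>T \<Phi>P where "\<Phi>A = fl \<sigma> A" and "\<Phi>T = fl \<sigma> T" and "\<Phi>P = fl \<sigma> P"
  have Ck: "C_k k \<Phi>A" "C_k k \<Phi>T" "C_k k \<Phi>P" for k
    unfolding \<Phi>A_def \<Phi>T_def \<Phi>P_def by (intro C_k_fl[OF _ a] gA gT gP)+
  have Dk: "\<Phi>A differentiable (at x)" "partial_deriv j \<Phi>A differentiable (at x)"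
    "\<Phi>T differentiable (at x)" "partial_deriv j \<Phi>T differentiable (at x)"
    "\<Phi>P differentiable (at x)" "partial_deriv j \<Phi>P differentiable (at x)" for j x
    using Ck[of 2] by (auto simp: numeral_2_eq_2 differentiable_on_UNIV)
  let ?B = "cball 0 2 :: (real ^ 'n) set"
  obtain MA where MA: "0 \<le> MA" "\<And>x. x \<in> ?B \<Longrightarrow> \<bar>\<Phi>A x\<bar> \<le> MA"
    "\<And>x j. x \<in> ?B \<Longrightarrow> \<bar>partial_deriv j \<Phi>A x\<bar> \<le> MA"
    "\<And>x j k. x \<in> ?B \<Longrightarrow> \<bar>partial_deriv j (partial_deriv k \<Phi>A) x\<bar> \<le> MA"
    using C2_bounded_compact[OF Ck(1) compact_cball] by metis
  obtain MT where MT: "0 \<le> MT" "\<And>x. x \<in> ?B \<Longrightarrow> \<bar>\<Phi>T x\<bar> \<le> MT"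
    "\<And>x j. x \<in> ?B \<Longrightarrow> \<bar>partial_deriv j \<Phi>T x\<bar> \<le> MT"
    "\<And>x j k. x \<in> ?B \<Longrightarrow> \<bar>partial_deriv j (partial_deriv k \<Phi>T) x\<bar> \<le> MT"
    using C2_bounded_compact[OF Ck(2) compact_cball] by metis
  obtain MP where MP: "0 \<le> MP" "\<And>x. x \<in> ?B \<Longrightarrow> \<bar>\<Phi>P x\<bar> \<le> MP"
    "\<And>x j. x \<in> ?B \<Longrightarrow> \<bar>partial_deriv j \<Phi>P x\<bar> \<le> MP"
    "\<And>x j k. x \<in> ?B \<Longrightarrow> \<bar>partial_deriv j (partial_deriv k \<Phi>P) x\<bar> \<le> MP"
    using C2_bounded_compact[OF Ck(3) compact_cball] by metis
  have x_le: "x $ i \<le> 3 - 1" if "x \<in> ?B" for x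
    using that component_le_norm_cart[of x i] by simp
  have neg: "\<Phi>P x < 0" "partial_deriv i \<Phi>P x < 0" if "x \<in> ?B" for x
    unfolding \<Phi>P_def using fl_halfspace_neg[OF gP a P0 P_pos x_le[OF that]] by auto
  have cont: "continuous_on ?B \<Phi>P" "continuous_on ?B (partial_deriv i \<Phi>P)"
    using Dk(5,6) by (auto intro!: continuous_at_imp_continuous_on differentiable_imp_continuous_within)
  obtain \<kappa>1 where \<kappa>1: "0 < \<kappa>1" "\<And>x. x \<in> ?B \<Longrightarrow> \<Phi>P x \<le> - \<kappa>1"
    using continuous_neg_compact[OF cont(1) compact_cball neg(1)] by metis
  obtain \<kappa>2 where \<kappa>2: "0 < \<kappa>2" "\<And>x. x \<in> ?B \<Longrightarrow> partial_deriv i \<Phi>P x \<le> - \<kappa>2"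
    using continuous_neg_compact[OF cont(2) compact_cball neg(2)] by metis
  define \<kappa> where "\<kappa> = min \<kappa>1 \<kappa>2"
  \<comment> \<open>Adding 1 makes M positive, as the division in \<delta> requires. By \<delta> M
    \<le> \<kappa>/4 the two error terms together stay below \<kappa>/2, half of the margin \<kappa>
    left by the limit profile.\<close>
  define M where "M = max MA (max MT MP) + 1"
  define \<delta> where "\<delta> = min 1 (\<kappa> / (4 * M))"
  have M: "MA \<le> M" "MT \<le> M" "MP \<le> M" "1 \<le> M" using MA(1) by (auto simp: M_def)
  have \<kappa>: "0 < \<kappa>" "\<kappa> \<le> \<kappa>1" "\<kappa> \<le> \<kappa>2" using \<kappa>1 \<kappa>2 by (auto simp: \<kappa>_def)
  have \<delta>: "0 < \<delta>" "\<delta> \<le> 1" using \<kappa> M by (auto simp: \<delta>_def)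
  have \<delta>M: "\<delta> * M \<le> \<kappa> / 4"
  proof -
    have "\<delta> * M \<le> \<kappa> / (4 * M) * M" using M by (intro mult_right_mono) (auto simp: \<delta>_def)
    then show ?thesis using M by simp
  qed
  text \<open>\<open>s l\<close> is the inverse of the radius beyond which \<open>u l\<close> starts to decay.\<close>
  have "\<exists>s. 0 < s \<and> s \<le> 1 / 3 \<and> l powr (1 - p) * s powr (2 * \<sigma>) \<le> \<delta> \<and> l powr (- p) * s powr (q + 2 * \<sigma>) \<le> \<delta>" for l
    using assms \<delta> by (intro exists_small_scale) auto
  then obtain s where s: "\<And>l. 0 < s l" "\<And>l. s l \<le> 1 / 3"
    "\<And>l. l powr (1 - p) * s l powr (2 * \<sigma>) \<le> \<delta>"
    "\<And>l. l powr (- p) * s l powr (q + 2 * \<sigma>) \<le> \<delta>"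
    by metis
  \<comment> \<open>The factor \<open>s l powr q\<close> undoes the effect of the dilation on the
    limit of the tail profile at infinity.\<close>
  define u where "u l x = l * A (s l *\<^sub>R x) + s l powr q * T (s l *\<^sub>R x) + l powr p * P x" for l x
  define L where "L l x = l * (s l powr (2 * \<sigma>) * \<Phi>A (s l *\<^sub>R x)) +
      s l powr q * (s l powr (2 * \<sigma>) * \<Phi>T (s l *\<^sub>R x)) + l powr p * \<Phi>P x" for l x
  define K where "K l x = L l x * u l x powr (- p)" for l x
  \<comment> \<open>This is \<open>L l x * l powr (- p)\<close>, the form of K where u = l. It is
    linear in the three profiles, so its derivatives do not involve those of u.\<close>
  define H where "H l x = (l powr (1 - p) * s l powr (2 * \<sigma>)) * \<Phi>A (s l *\<^sub>R x) +
      (l powr (- p) * s l powr (q + 2 * \<sigma>)) * \<Phi>T (s l *\<^sub>R x) + \<Phi>P x" for l x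
  have u_pos: "0 < u l x" if "1 \<le> l" for l x
    unfolding u_def using that A_pos T_nonneg P_nonneg by (intro add_pos_nonneg mult_pos_pos) auto
  have u_Ck: "C_k k (u l)" for k l
    unfolding u_def[abs_def]
    by (intro C_k_add C_k_mult C_k_const C_k_scaleR growth_imp_C_k[OF gA] growth_imp_C_k[OF gT] growth_imp_C_k[OF gP])
  have L_Ck: "C_k k (L l)" for k l
    unfolding L_def[abs_def] by (intro C_k_add C_k_mult C_k_const C_k_scaleR Ck)
  have K_Ck: "C_k k (K l)" if "1 \<le> l" for k l
    unfolding K_def[abs_def] by (intro C_k_mult L_Ck C_k_powr u_Ck u_pos that)
  have u_L: "has_frac_laplacian \<sigma> (u l) x (L l x)" for l x
    unfolding u_def[abs_def] L_def \<Phi>A_def \<Phi>T_def \<Phi>P_def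
    by (intro has_frac_laplacian_add has_frac_laplacian_cmult has_frac_laplacian_scaleR s meas
        has_frac_laplacian_fl[OF gA a] has_frac_laplacian_fl[OF gT a] has_frac_laplacian_fl[OF gP a])
  have LK: "L l x = K l x * u l x powr p" if "1 \<le> l" for l x
    using u_pos[OF that, of x] by (simp add: K_def mult.assoc flip: powr_add)
  \<comment> \<open>The bound 1/3 on \<open>s l\<close> brings the closed ball of radius 2 into the
    unit ball, where the bump is 1 and the tail profile is 0.\<close>
  have scaled: "norm (s l *\<^sub>R x) \<le> 1" if "norm x \<le> 2" for l x
    using mult_mono[OF s(2)[of l] that] s(1)[of l] by simp
  have u_eq: "u l x = l" if "norm x \<le> 2" for l x
  proof -
    have "x $ i \<le> 3" using that component_le_norm_cart[of x i] by simp
    then show ?thesis using scaled[OF that] by (simp add: u_def A1 T0 P0)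
  qed
  have K_eq: "K l x = H l x" if "1 \<le> l" "x \<in> ball 0 2" for l x
  proof -
    have "l * l powr (- p) = l powr (1 - p)" "l powr p * l powr (- p) = 1"
      using that by (simp_all add: powr_diff powr_minus field_simps)
    then have "L l x * l powr (- p) = H l x"
      unfolding L_def H_def powr_add distrib_right
      by (simp add: mult_ac)
    then show ?thesis using that by (simp add: K_def u_eq)
  qed
  have H1: "partial_deriv j (H l) = (\<lambda>x. (l powr (1 - p) * s l powr (2 * \<sigma>) * s l) * partial_deriv j \<Phi>A (s l *\<^sub>R x) +
      (l powr (- p) * s l powr (q + 2 * \<sigma>) * s l) * partial_deriv j \<Phi>T (s l *\<^sub>R x) + partial_deriv j \<Phi>P x)" for j l
    unfolding H_def[abs_def] by (intro partial_deriv_scaled_combination Dk)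
  have H2: "partial_deriv k (partial_deriv j (H l)) = (\<lambda>x. (l powr (1 - p) * s l powr (2 * \<sigma>) * s l * s l) *
      partial_deriv k (partial_deriv j \<Phi>A) (s l *\<^sub>R x) +
      (l powr (- p) * s l powr (q + 2 * \<sigma>) * s l * s l) * partial_deriv k (partial_deriv j \<Phi>T) (s l *\<^sub>R x) +
      partial_deriv k (partial_deriv j \<Phi>P) x)" for j k l
    unfolding H1 by (intro partial_deriv_scaled_combination Dk)
  \<comment> \<open>Each derivative brings down a factor \<open>s l\<close>, at most 1, so the
    coefficients remain within \<delta> for the gradient and the Hessian.\<close>
  have small: "0 \<le> e * s l" "e * s l \<le> \<delta>" if "0 \<le> e" "e \<le> \<delta>" for e l
    using that s(1,2)[of l] mult_left_mono[of "s l" 1 e] by auto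
  have err: "\<bar>\<alpha> * y + \<beta> * z\<bar> \<le> \<kappa> / 2"
    if "0 \<le> \<alpha>" "\<alpha> \<le> \<delta>" "0 \<le> \<beta>" "\<beta> \<le> \<delta>" "\<bar>y\<bar> \<le> MA" "\<bar>z\<bar> \<le> MT" for \<alpha> \<beta> y z :: real
  proof -
    have "\<bar>\<alpha> * y\<bar> \<le> \<delta> * M" "\<bar>\<beta> * z\<bar> \<le> \<delta> * M"
      unfolding abs_mult using that M \<delta> by (auto intro!: mult_mono)
    then show ?thesis using \<delta>M by linarith
  qed
  \<comment> \<open>Evaluated at the origin, where |\<Phi>P| is at least \<kappa> and at most M.
    Together with the error \<kappa>/2 this gives the bound 2M below.\<close>
  have \<kappa>M: "\<kappa> \<le> M"
    using \<kappa>1(2)[of 0] MP(2)[of 0] \<kappa> M by (simp add: abs_le_iff)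
  \<comment> \<open>One factor n for the rows of the Hessian and one for the entries of a
    row.\<close>
  define C where "C = real CARD('n) * (real CARD('n) * (2 * M))"
  have n1: "1 \<le> real CARD('n)" by (simp add: Suc_leI)
  have CM: "2 * M \<le> real CARD('n) * (2 * M)" "real CARD('n) * (2 * M) \<le> C"
    using mult_right_mono[OF n1, of "2 * M"] mult_right_mono[OF n1, of "real CARD('n) * (2 * M)"] M
    by (simp_all add: C_def)
  have KH: "K l x = H l x" "partial_deriv j (K l) x = partial_deriv j (H l) x"
      "partial_deriv k (partial_deriv j (K l)) x = partial_deriv k (partial_deriv j (H l)) x"
    if "1 \<le> l" "x \<in> ball 0 2" for l x j k
  proof -
    show "K l x = H l x" by (rule K_eq[OF that])
    have 1: "partial_deriv j (K l) y = partial_deriv j (H l) y" if "y \<in> ball 0 2" for y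
      by (rule partial_deriv_cong_open[OF open_ball that K_eq[OF \<open>1 \<le> l\<close>]])
    show "partial_deriv j (K l) x = partial_deriv j (H l) x" by (rule 1[OF that(2)])
    show "partial_deriv k (partial_deriv j (K l)) x = partial_deriv k (partial_deriv j (H l)) x"
      by (rule partial_deriv_cong_open[OF open_ball that(2) 1])
  qed
  have bounds: "- C \<le> K l x \<and> K l x \<le> - (\<kappa> / 2) \<and>
        \<kappa> / 2 \<le> norm (gradient (K l) x) \<and> norm (gradient (K l) x) \<le> C \<and> norm (hessian (K l) x) \<le> C"
    if l: "1 \<le> l" and x: "x \<in> ball 0 2" for l x
  proof -
    let ?\<alpha> = "l powr (1 - p) * s l powr (2 * \<sigma>)" and ?\<beta> = "l powr (- p) * s l powr (q + 2 * \<sigma>)"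
    have xB: "x \<in> ?B" and sB: "s l *\<^sub>R x \<in> ?B"
      using x scaled[of x l] by auto
    have \<alpha>: "0 \<le> ?\<alpha>" "?\<alpha> \<le> \<delta>" and \<beta>: "0 \<le> ?\<beta>" "?\<beta> \<le> \<delta>" using s by auto
    note \<alpha>1 = small[OF \<alpha>, of l] and \<beta>1 = small[OF \<beta>, of l]
    note \<alpha>2 = small[OF \<alpha>1, of l] and \<beta>2 = small[OF \<beta>1, of l]
    have e0: "\<bar>H l x - \<Phi>P x\<bar> \<le> \<kappa> / 2"
      using err[OF \<alpha> \<beta> MA(2)[OF sB] MT(2)[OF sB]] by (simp add: H_def)
    have e1: "\<bar>partial_deriv j (H l) x - partial_deriv j \<Phi>P x\<bar> \<le> \<kappa> / 2" for j
      using err[OF \<alpha>1 \<beta>1 MA(3)[OF sB] MT(3)[OF sB], of j j] by (simp add: H1)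
    have e2: "\<bar>partial_deriv k (partial_deriv j (H l)) x - partial_deriv k (partial_deriv j \<Phi>P) x\<bar> \<le> \<kappa> / 2" for j k
      using err[OF \<alpha>2 \<beta>2 MA(4)[OF sB] MT(4)[OF sB], of k j k j] by (simp add: H2)
    note KH = KH[OF l x]
    have K0: "\<bar>K l x\<bar> \<le> 2 * M" "K l x \<le> - (\<kappa> / 2)"
      unfolding KH using e0 MP(2)[OF xB] \<kappa>1(2)[OF xB] \<kappa> M \<kappa>M by linarith+
    have K1: "\<bar>partial_deriv j (K l) x\<bar> \<le> 2 * M" for j
      unfolding KH using e1[of j] MP(3)[OF xB, of j] \<kappa> M \<kappa>M by linarith
    have K2: "\<bar>partial_deriv k (partial_deriv j (K l)) x\<bar> \<le> 2 * M" for j k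
      unfolding KH using e2[of k j] MP(4)[OF xB, of k j] \<kappa> M \<kappa>M by linarith
    have "partial_deriv i (K l) x \<le> - (\<kappa> / 2)"
      unfolding KH using e1[of i] \<kappa>2(2)[OF xB] \<kappa> by linarith
    \<comment> \<open>The i-th component alone bounds the gradient from below, since that derivative
      stays negative on the whole ball.\<close>
    then have "\<kappa> / 2 \<le> \<bar>gradient (K l) x $ i\<bar>" by (simp add: gradient_def)
    then have "\<kappa> / 2 \<le> norm (gradient (K l) x)"
      using component_le_norm_cart[of "gradient (K l) x" i] by linarith
    moreover have "norm (gradient (K l) x) \<le> real CARD('n) * (2 * M)"
      by (rule norm_vec_le_sum) (use K1 in \<open>simp add: gradient_def\<close>)
    moreover have "norm (hessian (K l) x) \<le> C"
      unfolding C_def by (intro norm_vec_le_sum) (use K2 in \<open>simp add: hessian_def\<close>)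
    ultimately show ?thesis using K0 CM by linarith
  qed
  have lim: "((\<lambda>x. norm x powr q * u l x) \<longlongrightarrow> 1) at_infinity" for l
  proof -
    have lA: "((\<lambda>x. norm x powr q * A x) \<longlongrightarrow> 0) at_infinity"
      unfolding A_def by (rule tendsto_powr_one_minus_flat_step[OF m])
    have lT: "((\<lambda>x. norm x powr q * T x) \<longlongrightarrow> 1) at_infinity"
      unfolding T_def by (rule tendsto_powr_flat_step_wt)
    have lP: "((\<lambda>x. norm x powr q * P x) \<longlongrightarrow> 0) at_infinity"
      unfolding P_def by (rule tendsto_powr_flat_halfspace) (use m in simp)
    have "((\<lambda>x. l * (norm x powr q * A (s l *\<^sub>R x)) + s l powr q * (norm x powr q * T (s l *\<^sub>R x)) +
        l powr p * (norm x powr q * P x)) \<longlongrightarrow>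
        l * (s l powr (- q) * 0) + s l powr q * (s l powr (- q) * 1) + l powr p * 0) at_infinity"
      by (intro tendsto_add tendsto_mult tendsto_const tendsto_powr_scaleR lA lT lP s)
    moreover have "s l powr q * s l powr (- q) = 1" using s(1)[of l] by (simp flip: powr_add)
    ultimately show ?thesis by (simp add: u_def algebra_simps)
  qed
  \<comment> \<open>On the unit ball u is the constant l, so the infimum is attained and equals
    l.\<close>
  have "(INF x\<in>cball 0 1. u l x) = l" for l
  proof -
    have "(INF x\<in>cball 0 1. u l x) = (INF x\<in>cball (0::real ^ 'n) 1. l)"
      by (intro INF_cong) (auto simp: u_eq)
    then show ?thesis by simp
  qed
  then have inf: "filterlim (\<lambda>l. INF x\<in>cball 0 1. u l x) at_top at_top"
    by (simp add: filterlim_ident)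
  have C: "0 < C" using CM M by linarith
  show ?thesis
  proof (intro exI conjI)
    show "0 < \<kappa> / 2" using \<kappa> by simp
    show "0 < C" by (rule C)
    show "\<forall>l\<ge>1. C_infinity (K l)" using K_Ck by (simp add: C_infinity_def)
    show "\<forall>l\<ge>1. \<forall>x\<in>ball 0 2. - C \<le> K l x \<and> K l x \<le> - (\<kappa> / 2) \<and>
        \<kappa> / 2 \<le> norm (gradient (K l) x) \<and> norm (gradient (K l) x) \<le> C \<and> norm (hessian (K l) x) \<le> C"
      using bounds by blast
    show "\<forall>l\<ge>1. C_infinity (u l) \<and> (\<forall>x. 0 < u l x)"
      using u_Ck u_pos by (simp add: C_infinity_def)
    show "\<forall>l\<ge>1. (\<forall>x. has_frac_laplacian \<sigma> (u l) x (K l x * u l x powr p)) \<and>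
        ((\<lambda>x. norm x powr q * u l x) \<longlongrightarrow> 1) at_infinity"
      using u_L LK lim by metis
    show "filterlim (\<lambda>l. INF x\<in>cball 0 1. u l x) at_top at_top" by (rule inf)
  qed
qed

end
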